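(* Let $k\ge2$ be an integer and let $\mathbb T_n^{\rm bi}$ be the complete binary tree with $n$ vertices. Then its $k$-cut number satisfies $$n^{-1}(\log_2 n)^{1/k}\,\mathcal K(\mathbb T_n^{\rm bi})\xrightarrow{d}(k!)^{1/k}\,\Gamma\Big(1+\frac1k\Big)\quad\text{as } n\to\infty,$$ i.e. convergence in distribution to a constant.
   Context: The $k$-cut number $\mathcal K(T)$ of a finite rooted tree $T$ is the random total number of cuts made in the following procedure. Step 1: choose a vertex uniformly at random from the component that currently contains the root and cut it once. Step 2: if this vertex has now been cut $k$ times, remove it together with the edges attached to it. Step 3: if the root has been removed, stop; otherwise go to Step 1. The complete binary tree with $n$ vertices is the rooted binary tree of height $h=\lfloor\log_2 n\rfloor$ with $2^i$ vertices at depth $i$ for $0\le i\le h-1$, and $n-2^{h}+1$ vertices at depth $h$, the latter occupying the leftmost of the $2^h$ possible positions. $\Gamma(\cdot)$ is the gamma function. *)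

theory Defs
  imports "HOL-Probability.Probability"
begin

section \<open>The \<open>k\<close>-cut number of a finite rooted tree\<close>

text \<open>
  A rooted tree is given by its parent map; the value \<open>parent root\<close> is irrelevant.
\<close>

locale finite_rooted_tree =
  fixes verts :: "'v set" and root :: 'v and parent :: "'v \<Rightarrow> 'v"
  assumes finite_verts: "finite verts"
    and root_in_verts: "root \<in> verts"
    and parent_in_verts: "v \<in> verts \<Longrightarrow> v \<noteq> root \<Longrightarrow> parent v \<in> verts"
    and reaches_root: "v \<in> verts \<Longrightarrow> \<exists>i. (parent ^^ i) v = root"
begin

text \<open>The edges are undirected: both orientations of each edge are included.\<close>

definition edges :: "'v rel" where
  "edges = {(v, parent v) | v. v \<in> verts - {root}} \<union> {(parent v, v) | v. v \<in> verts - {root}}"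

text \<open>
  A state of the procedure is the map \<open>c\<close> that gives the number of cuts each vertex has received
  so far.
\<close>

definition remaining :: "nat \<Rightarrow> ('v \<Rightarrow> nat) \<Rightarrow> 'v set" where
  "remaining k c = {v \<in> verts. c v < k}"

definition root_component :: "nat \<Rightarrow> ('v \<Rightarrow> nat) \<Rightarrow> 'v set" where
  "root_component k c =
     {v \<in> remaining k c. (root, v) \<in> (edges \<inter> remaining k c \<times> remaining k c)\<^sup>*}"

lemma finite_root_component: "finite (root_component k c)"
  unfolding root_component_def remaining_def using finite_verts by auto

lemma root_in_root_component: "root \<in> remaining k c \<Longrightarrow> root \<in> root_component k c"
  unfolding root_component_def by auto

text \<open>\<open>cuts_from k c\<close> is the law of the number of cuts still to be made from state \<open>c\<close> on.\<close>

function cuts_from :: "nat \<Rightarrow> ('v \<Rightarrow> nat) \<Rightarrow> nat pmf" where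
  "cuts_from k c =
     (if root \<notin> remaining k c then return_pmf 0
      else bind_pmf (pmf_of_set (root_component k c))
             (\<lambda>v. map_pmf Suc (cuts_from k (c(v := Suc (c v))))))"
  by pat_completeness auto
termination
proof (relation "Wellfounded.measure (\<lambda>(k, c). \<Sum>v\<in>verts. k - c v)")
  fix k :: nat and c v
  assume "\<not> root \<notin> remaining k c" and v: "v \<in> set_pmf (pmf_of_set (root_component k c))"
  then have "root_component k c \<noteq> {}"
    using root_in_root_component by blast
  with v have "v \<in> root_component k c"
    by (simp add: set_pmf_of_set finite_root_component)
  then have "v \<in> verts" "c v < k"
    by (auto simp: root_component_def remaining_def)
  then have "(\<Sum>w\<in>verts. k - (c(v := Suc (c v))) w) < (\<Sum>w\<in>verts. k - c w)"
    by (intro sum_strict_mono_ex1 finite_verts) (auto intro!: bexI[of _ v])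
  then show "((k, c(v := Suc (c v))), k, c) \<in> Wellfounded.measure (\<lambda>(k, c). \<Sum>v\<in>verts. k - c v)"
    by simp
qed simp

declare cuts_from.simps [simp del]

definition kcut_number :: "nat \<Rightarrow> nat pmf" where
  "kcut_number k = cuts_from k (\<lambda>_. 0)"

end


section \<open>Complete binary trees\<close>

text \<open>
  The pair \<open>(d, j)\<close> is the \<open>j\<close>-th position from the left (counting from \<open>0\<close>) at depth \<open>d\<close>.
\<close>

definition cbt_height :: "nat \<Rightarrow> nat" where
  "cbt_height n = nat \<lfloor>log 2 (real n)\<rfloor>"

definition cbt_verts :: "nat \<Rightarrow> (nat \<times> nat) set" where
  "cbt_verts n =
     {(d, j). d < cbt_height n \<and> j < 2 ^ d} \<union>
     {(d, j). d = cbt_height n \<and> j < n - 2 ^ cbt_height n + 1}"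

definition cbt_root :: "nat \<times> nat" where
  "cbt_root = (0, 0)"

definition cbt_parent :: "nat \<times> nat \<Rightarrow> nat \<times> nat" where
  "cbt_parent = (\<lambda>(d, j). (d - 1, j div 2))"

lemma cbt_height_bounds:
  assumes "n > 0"
  shows "2 ^ cbt_height n \<le> n" "n < 2 ^ Suc (cbt_height n)"
proof -
  define h where "h = cbt_height n"
  have "\<lfloor>log 2 (real n)\<rfloor> = int h"
    using assms by (simp add: h_def cbt_height_def)
  then have h: "real h \<le> log 2 n" "log 2 n < real (Suc h)"
    by linarith+
  have "2 powr real h \<le> real n" "real n < 2 powr real (Suc h)"
    using h assms by (auto simp: le_log_iff log_less_iff)
  then have "real (2 ^ h) \<le> real n" "real n < real (2 ^ Suc h)"
    by (simp_all add: powr_realpow del: of_nat_Suc power_Suc)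
  then show "2 ^ cbt_height n \<le> n" "n < 2 ^ Suc (cbt_height n)"
    by (simp_all only: h_def of_nat_le_iff of_nat_less_iff)
qed

lemma cbt_verts_bound: "(d, j) \<in> cbt_verts n \<Longrightarrow> j < 2 ^ d"
  using cbt_height_bounds[of n]
  by (cases "n = 0") (auto simp: cbt_verts_def cbt_height_def)

lemma cbt_verts_parts:
  "cbt_verts n =
     Sigma {..<cbt_height n} (\<lambda>d. {..<2 ^ d}) \<union>
     {cbt_height n} \<times> {..<n - 2 ^ cbt_height n + 1}"
  by (auto simp: cbt_verts_def)

lemma card_cbt_verts:
  assumes "n > 0"
  shows "card (cbt_verts n) = n"
proof -
  have "card (cbt_verts n) = (\<Sum>d<cbt_height n. 2 ^ d) + (n - 2 ^ cbt_height n + 1)"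
    unfolding cbt_verts_parts
    by (subst card_Un_disjoint) (auto simp: card_cartesian_product)
  also have "(\<Sum>d<cbt_height n. 2 ^ d :: nat) = 2 ^ cbt_height n - 1"
    by (simp add: lessThan_atLeast0 sum_power2)
  finally show ?thesis
    using cbt_height_bounds(1)[OF assms] assms by simp
qed

text \<open>For \<open>n = 0\<close> the definitions give the tree with one vertex.\<close>

interpretation cbt: finite_rooted_tree "cbt_verts n" cbt_root cbt_parent for n
proof
  show "finite (cbt_verts n)"
    by (auto simp: cbt_verts_parts)
  show "cbt_root \<in> cbt_verts n"
    by (auto simp: cbt_verts_def cbt_root_def)
next
  fix v
  assume v: "v \<in> cbt_verts n" "v \<noteq> cbt_root"
  obtain d j where dj: "v = (d, j)"
    by fastforce
  have j: "j < 2 ^ d"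
    using cbt_verts_bound v dj by blast
  with v dj obtain e where e: "d = Suc e"
    by (cases d) (auto simp: cbt_root_def)
  have "e < cbt_height n"
    using v dj e by (auto simp: cbt_verts_def)
  then show "cbt_parent v \<in> cbt_verts n"
    using j by (auto simp: dj e cbt_verts_def cbt_parent_def)
next
  fix v
  assume v: "v \<in> cbt_verts n"
  have "(cbt_parent ^^ d) (d, j) = (0, j div 2 ^ d)" for d j
  proof (induction d arbitrary: j)
    case (Suc d)
    then show ?case
      by (simp add: funpow_Suc_right cbt_parent_def div_mult2_eq del: funpow.simps)
  qed simp
  then show "\<exists>i. (cbt_parent ^^ i) v = cbt_root"
    using v cbt_verts_bound[of "fst v" "snd v" n]
    by (intro exI[of _ "fst v"]) (metis cbt_root_def div_less prod.collapse)
qed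

end

theory Submission
  imports Defs "HOL-Real_Asymp.Real_Asymp"
begin

text \<open>
  Let every vertex carry an independent Poisson clock of rate one and be cut whenever its clock
  rings, ignoring the rings of vertices that have lost their connection to the root. The successive cuts follow
  the law of the procedure. In this continuous-time version a vertex belongs to the root component at time
  \<open>t\<close> if and only if the clocks on its path to the root have all rung fewer than \<open>k\<close> times, an
  intersection of independent events of probability \<open>q t = erlang_tail k t\<close> each. Since cuts happen at a
  rate equal to the size \<open>N t\<close> of the root component, the number \<open>K\<close> of cuts satisfies
  \<open>E K = \<integral> E (N t) dt\<close> and \<open>E (K * (K + 1)) = \<integral>\<integral> E (N t * N t') dt dt'\<close>, and both integrands are sums of
  explicit products of values of \<open>q\<close>.

  No clocks are constructed below. The integrals are shown to satisfy the recursions that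
  determine the moments of \<open>cuts_from\<close>; the common source of these recursions is the backward
  equation of the continuous-time process, integrated over time (\<open>survival_balance\<close>, used in
  \<open>nn_integral_cuts_from\<close> and \<open>nn_integral_cuts_from_rising\<close>).

  A vertex at depth \<open>d\<close> contributes \<open>tail_integral k (d + 1)\<close>, the integral of \<open>q t ^ (d + 1)\<close>, to the
  first moment. As \<open>q t\<close> is about \<open>1 - t ^ k / fact k\<close> for small \<open>t\<close>, the integral of \<open>q t ^ a\<close> is
  asymptotic to that of \<open>exp (- a * t ^ k / fact k)\<close>, which is \<open>(fact k / a) powr (1 / k) * Gamma (1 + 1 / k)\<close>
  (\<open>tail_integral_asymptotics\<close>). In the complete binary tree almost all vertices have a depth close to
  \<open>log 2 n\<close>, and almost all pairs of vertices have few common ancestors, so that their contributions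
  to the second moment nearly factorise (\<open>nn_integral_cbt_kcut_number_rising_upper\<close>). Thus the second
  moment is asymptotic to the square of the first, and Chebyshev's inequality gives convergence to a
  constant (\<open>second_moment_weak_conv\<close>).
\<close>

section \<open>Tails of Erlang distributions\<close>

text \<open>
  The probability that a Poisson process of rate one has made fewer than \<open>m\<close> arrivals by time \<open>t\<close>:
  a vertex with \<open>m\<close> cuts left to receive is still present at time \<open>t\<close>.
\<close>
definition erlang_tail :: "nat \<Rightarrow> real \<Rightarrow> real" where
  "erlang_tail m t = exp (- t) * (\<Sum>j<m. t ^ j / fact j)"

lemma erlang_tail_0 [simp]: "erlang_tail 0 t = 0"
  by (simp add: erlang_tail_def)

lemma erlang_tail_at_0: "erlang_tail m 0 = (if m = 0 then 0 else 1)"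
proof (cases m)
  case (Suc i)
  have "(\<Sum>j<Suc i. (0::real) ^ j / fact j) = (\<Sum>j<Suc i. if j = 0 then 1 else 0)"
    by (intro sum.cong) auto
  then show ?thesis
    using Suc by (simp add: erlang_tail_def)
qed simp

lemma erlang_tail_nonneg: "0 \<le> t \<Longrightarrow> 0 \<le> erlang_tail m t"
  by (simp add: erlang_tail_def sum_nonneg)

lemma erlang_tail_Suc: "erlang_tail (Suc m) t = erlang_tail m t + exp (- t) * t ^ m / fact m"
  by (simp add: erlang_tail_def distrib_left)

lemma erlang_tail_mono: "0 \<le> t \<Longrightarrow> m \<le> m' \<Longrightarrow> erlang_tail m t \<le> erlang_tail m' t"
  unfolding erlang_tail_def by (intro mult_left_mono sum_mono2) auto

lemma erlang_tail_le_1: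
  assumes "0 \<le> t"
  shows "erlang_tail m t \<le> 1"
proof -
  have "(\<Sum>j<m. t ^ j / fact j) \<le> exp t"
    using sum_le_suminf[OF summable_exp[of t], of "{..<m}"] assms
    by (simp add: exp_def scaleR_conv_of_real divide_inverse mult.commute)
  then have "erlang_tail m t \<le> exp (- t) * exp t"
    unfolding erlang_tail_def by (intro mult_left_mono) auto
  then show ?thesis
    by (simp add: exp_minus)
qed

lemma DERIV_poisson_term:
  "((\<lambda>t::real. exp (- t) * t ^ Suc i / fact (Suc i)) has_real_derivative
        exp (- t) * t ^ i / fact i - exp (- t) * t ^ Suc i / fact (Suc i)) (at t)"
proof -
  have "((\<lambda>t::real. exp (- t) * t ^ Suc i / fact (Suc i)) has_real_derivative
        (exp (- t) * (real (Suc i) * t ^ i) - exp (- t) * t ^ Suc i) / fact (Suc i)) (at t)"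
    by (auto intro!: derivative_eq_intros simp del: power_Suc fact_Suc of_nat_Suc simp: field_simps)
  also have "(exp (- t) * (real (Suc i) * t ^ i) - exp (- t) * t ^ Suc i) / fact (Suc i) = exp (- t) * (t ^ i * (real (Suc i) / fact (Suc i)))  - exp (- t) * t ^ Suc i / fact (Suc i)"
    by (simp add: diff_divide_distrib del: power_Suc fact_Suc of_nat_Suc)
  also have "real (Suc i) / fact (Suc i) = 1 / fact i"
    by (simp del: of_nat_Suc)
  finally show ?thesis by simp
qed

text \<open>
  At rate one an arrival turns \<open>m\<close> missing arrivals into \<open>m - 1\<close>; this is the backward equation of
  a single clock, from which \<open>survival_balance\<close> follows by the product rule.
\<close>
lemma DERIV_erlang_tail:
  "m > 0 \<Longrightarrow> (erlang_tail m has_real_derivative erlang_tail (m - 1) t - erlang_tail m t) (at t)"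
proof (induction m)
  case (Suc m)
  have *: "erlang_tail (Suc m) = (\<lambda>t. erlang_tail m t + exp (- t) * t ^ m / fact m)"
    by (simp add: erlang_tail_Suc fun_eq_iff)
  show ?case
  proof (cases m)
    case 0
    then show ?thesis
      by (auto simp: * erlang_tail_Suc intro!: derivative_eq_intros)
  next
    case (Suc i)
    have "(erlang_tail m has_real_derivative erlang_tail i t - erlang_tail m t) (at t)"
      using Suc.IH Suc by simp
    moreover have "((\<lambda>t. exp (- t) * t ^ m / fact m) has_real_derivative
        exp (- t) * t ^ i / fact i - exp (- t) * t ^ m / fact m) (at t)"
      unfolding Suc by (rule DERIV_poisson_term)
    ultimately show ?thesis
      unfolding * by (rule DERIV_cong[OF DERIV_add]) (simp add: Suc erlang_tail_Suc)
  qed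
qed simp

lemma borel_measurable_erlang_tail [measurable]: "erlang_tail m \<in> borel_measurable borel"
  unfolding erlang_tail_def by measurable

lemma erlang_tail_tendsto_0: "(erlang_tail m \<longlongrightarrow> 0) at_top"
proof -
  have "((\<lambda>t::real. \<Sum>j<m. t ^ j / exp t / fact j) \<longlongrightarrow> (\<Sum>j<m. 0 / fact j)) at_top"
    by (intro tendsto_intros tendsto_power_div_exp_0) auto
  also have "(\<lambda>t::real. \<Sum>j<m. t ^ j / exp t / fact j) = erlang_tail m"
    by (auto simp: erlang_tail_def exp_minus field_simps sum_distrib_left)
  finally show ?thesis by simp
qed

section \<open>Paths to the root and the backward equation\<close>

context finite_rooted_tree
begin

definition root_path :: "'v \<Rightarrow> 'v set" where
  "root_path v = {u. \<exists>i. u = (parent ^^ i) v \<and> (\<forall>j<i. (parent ^^ j) v \<noteq> root)}"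

lemma path_root: "root_path root = {root}"
proof -
  have "i = 0" if "\<forall>j<i. (parent ^^ j) root \<noteq> root" for i
    using that by (cases i) auto
  then have "root_path root \<subseteq> {root}"
    unfolding root_path_def by fastforce
  moreover have "root \<in> root_path root"
    unfolding root_path_def by (auto intro: exI[of _ 0])
  ultimately show ?thesis by blast
qed

lemma self_in_path: "v \<in> root_path v"
  unfolding root_path_def by (auto intro: exI[of _ 0])

lemma path_step:
  assumes "v \<noteq> root"
  shows "root_path v = insert v (root_path (parent v))"
proof (intro set_eqI iffI)
  fix u assume "u \<in> root_path v"
  then obtain i where i: "u = (parent ^^ i) v" "\<forall>j<i. (parent ^^ j) v \<noteq> root"
    by (auto simp: root_path_def)
  show "u \<in> insert v (root_path (parent v))"
  proof (cases i)
    case (Suc i')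
    have "\<forall>j<i'. (parent ^^ j) (parent v) \<noteq> root"
    proof (intro allI impI)
      fix j assume "j < i'"
      then have "(parent ^^ Suc j) v \<noteq> root"
        using i Suc by blast
      then show "(parent ^^ j) (parent v) \<noteq> root"
        by (simp add: funpow_swap1)
    qed
    then show ?thesis
      using i Suc by (auto simp: root_path_def funpow_swap1)
  qed (use i in auto)
next
  fix u assume "u \<in> insert v (root_path (parent v))"
  then show "u \<in> root_path v"
  proof
    assume "u \<in> root_path (parent v)"
    then obtain i where i: "u = (parent ^^ i) (parent v)"
      "\<forall>j<i. (parent ^^ j) (parent v) \<noteq> root"
      by (auto simp: root_path_def)
    have "(parent ^^ j) v \<noteq> root" if "j < Suc i" for j
      using i(2) assms that by (cases j) (auto simp: funpow_swap1)
    moreover have "u = (parent ^^ Suc i) v"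
      using i(1) by (simp add: funpow_swap1)
    ultimately show ?thesis
      unfolding root_path_def by blast
  qed (simp add: self_in_path)
qed

lemma tree_induct [consumes 1, case_names root step]:
  assumes "v \<in> verts" "P root"
    and "\<And>v. v \<in> verts \<Longrightarrow> v \<noteq> root \<Longrightarrow> P (parent v) \<Longrightarrow> P v"
  shows "P v"
proof -
  obtain i where "(parent ^^ i) v = root"
    using reaches_root assms(1) by blast
  then show ?thesis
    using assms(1)
  proof (induction i arbitrary: v)
    case (Suc i)
    then show ?case
      using assms(2,3) parent_in_verts by (cases "v = root") (auto simp: funpow_swap1)
  qed (use assms(2) in simp)
qed

lemma path_subset_verts: "v \<in> verts \<Longrightarrow> root_path v \<subseteq> verts"
  by (induction rule: tree_induct) (auto simp: path_root path_step root_in_verts)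

lemma root_in_path: "v \<in> verts \<Longrightarrow> root \<in> root_path v"
  by (induction rule: tree_induct) (auto simp: path_root path_step)

lemma path_trans: "v \<in> verts \<Longrightarrow> u \<in> root_path v \<Longrightarrow> root_path u \<subseteq> root_path v"
  by (induction arbitrary: u rule: tree_induct) (auto simp: path_root path_step)

lemma finite_path: "v \<in> verts \<Longrightarrow> finite (root_path v)"
  using path_subset_verts finite_verts finite_subset by blast

text \<open>
  In a tree the only way from the root to \<open>v\<close> runs through all ancestors of \<open>v\<close>, so connectivity in
  the undirected graph reduces to a condition on one path. Membership in the root component thereby
  becomes an intersection of independent events.
\<close>
lemma root_component_eq:
  "root_component k c = {v \<in> verts. root_path v \<subseteq> remaining k c}" (is "_ = ?S")
proof (intro set_eqI iffI)
  fix v assume v: "v \<in> root_component k c"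
  let ?E = "edges \<inter> remaining k c \<times> remaining k c"
  have "(root, v) \<in> ?E\<^sup>*" "v \<in> remaining k c"
    using v by (auto simp: root_component_def)
  then have root: "root \<in> remaining k c"
    by (metis (no_types, lifting) IntE SigmaD1 converse_rtranclE)
  from \<open>(root, v) \<in> ?E\<^sup>*\<close> show "v \<in> ?S"
  proof (induction rule: rtrancl_induct)
    case base
    then show ?case
      using root by (auto simp: path_root root_in_verts)
  next
    case (step y z)
    then have "y = parent z \<and> z \<in> verts - {root} \<or> z = parent y \<and> y \<in> verts - {root}"
      by (auto simp: edges_def)
    then show ?case
      using step path_step[of z] path_step[of y] by (auto intro: parent_in_verts)
  qed
next
  fix v assume v: "v \<in> ?S"
  let ?E = "edges \<inter> remaining k c \<times> remaining k c"
  have "root_path v \<subseteq> remaining k c \<longrightarrow> (root, v) \<in> ?E\<^sup>*"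
    using v[THEN CollectD, THEN conjunct1]
  proof (induction rule: tree_induct)
    case (step v)
    have "(parent v, v) \<in> ?E" if "root_path v \<subseteq> remaining k c"
      using that step self_in_path[of v] self_in_path[of "parent v"]
      by (auto simp: path_step edges_def)
    then show ?case
      using step by (auto simp: path_step intro: rtrancl_into_rtrancl)
  qed simp
  then show "v \<in> root_component k c"
    using v self_in_path by (auto simp: root_component_def)
qed

text \<open>
  The probability that, from state \<open>c\<close> on, every \<open>u \<in> U\<close> is still present at time \<open>\<tau> u + t\<close>. The
  individual offsets \<open>\<tau> u\<close> are there for second moments, which look at the tree at two times at once.
\<close>
definition survival :: "nat \<Rightarrow> ('v \<Rightarrow> nat) \<Rightarrow> 'v set \<Rightarrow> ('v \<Rightarrow> real) \<Rightarrow> real \<Rightarrow> real" where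
  "survival k c U \<tau> t = (\<Prod>u\<in>U. erlang_tail (k - c u) (\<tau> u + t))"

lemma borel_measurable_survival [measurable]: "survival k c U \<tau> \<in> borel_measurable borel"
  unfolding survival_def by measurable

lemma survival_nonneg: "(\<And>u. 0 \<le> \<tau> u) \<Longrightarrow> 0 \<le> t \<Longrightarrow> 0 \<le> survival k c U \<tau> t"
  unfolding survival_def by (intro prod_nonneg erlang_tail_nonneg ballI) simp

lemma survival_eq_0: "finite U \<Longrightarrow> u \<in> U \<Longrightarrow> k \<le> c u \<Longrightarrow> survival k c U \<tau> t = 0"
  unfolding survival_def by (rule prod_zero) (auto intro!: bexI[of _ u])

lemma survival_tendsto_0:
  assumes "finite U" "u \<in> U" "\<And>u. 0 \<le> \<tau> u"
  shows "(survival k c U \<tau> \<longlongrightarrow> 0) at_top"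
proof (rule tendsto_sandwich)
  show "\<forall>\<^sub>F t in at_top. 0 \<le> survival k c U \<tau> t"
    using eventually_ge_at_top[of 0] by eventually_elim (simp add: survival_nonneg assms)
  show "\<forall>\<^sub>F t in at_top. survival k c U \<tau> t \<le> erlang_tail (k - c u) (\<tau> u + t)"
    using eventually_ge_at_top[of 0]
  proof eventually_elim
    case (elim t)
    have "survival k c U \<tau> t = erlang_tail (k - c u) (\<tau> u + t) * survival k c (U - {u}) \<tau> t"
      unfolding survival_def using assms by (subst prod.remove[of _ u]) auto
    also have "\<dots> \<le> erlang_tail (k - c u) (\<tau> u + t)"
      unfolding survival_def using assms elim
      by (intro mult_left_le prod_le_1 erlang_tail_nonneg) (auto simp: erlang_tail_nonneg erlang_tail_le_1)
    finally show ?case .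
  qed
  show "((\<lambda>t. erlang_tail (k - c u) (\<tau> u + t)) \<longlongrightarrow> 0) at_top"
    by (rule filterlim_compose[OF erlang_tail_tendsto_0])
      (simp add: filterlim_tendsto_add_at_top[OF tendsto_const] filterlim_ident)
qed simp

text \<open>
  In one step of the continuous-time process each vertex of the root component is cut at rate one, so
  the time derivative of a survival probability is the sum over \<open>x\<close> of its changes when \<open>x\<close> is
  cut. This holds although clocks outside the root component are stopped: if \<open>U\<close> contains such a vertex,
  then, being closed under ancestors, it contains a removed one, and all terms vanish. Integrating
  over time gives a discrete recursion with the same averaging over the root component as in
  \<open>cuts_from\<close>, without any reference to time.
\<close>
lemma survival_balance:
  assumes U: "U \<subseteq> verts" "U \<noteq> {}" "\<And>u. u \<in> U \<Longrightarrow> root_path u \<subseteq> U" and \<tau>: "\<And>u. 0 \<le> \<tau> u"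
  shows "of_nat (card (root_component k c)) * (\<integral>\<^sup>+t\<in>{0..}. survival k c U \<tau> t \<partial>lborel) =
     (\<Sum>x\<in>root_component k c. \<integral>\<^sup>+t\<in>{0..}. survival k (c(x := Suc (c x))) U \<tau> t \<partial>lborel)
     + ennreal (survival k c U \<tau> 0)"
proof (cases "\<exists>u\<in>U. k \<le> c u")
  case True
  then obtain u where u: "u \<in> U" "k \<le> c u" by blast
  have fin: "finite U" using U(1) finite_verts finite_subset by blast
  have "survival k c U \<tau> t = 0" for t
    using survival_eq_0[of U u k c] fin u by auto
  moreover have "survival k (c(x := Suc (c x))) U \<tau> t = 0" for x t
    using fin u by (intro survival_eq_0[of U u]) auto
  ultimately show ?thesis by simp
next
  case False
  have fin: "finite U" using U(1) finite_verts finite_subset by blast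
  let ?C = "root_component k c" and ?c = "\<lambda>x. c(x := Suc (c x))"
  define S where "S = survival k c U \<tau>"
  define S' where "S' = (\<lambda>x. survival k (?c x) U \<tau>)"
  have UC: "U \<subseteq> ?C"
    using U False unfolding root_component_eq remaining_def by (fastforce simp: not_le)
  have S': "S' x t = erlang_tail (k - c x - 1) (\<tau> x + t) * (\<Prod>u\<in>U-{x}. erlang_tail (k - c u) (\<tau> u + t))"
    if "x \<in> U" for x t
    unfolding S'_def survival_def using fin that by (subst prod.remove[of _ x]) auto
  have S: "S t = erlang_tail (k - c x) (\<tau> x + t) * (\<Prod>u\<in>U-{x}. erlang_tail (k - c u) (\<tau> u + t))"
    if "x \<in> U" for x t
    unfolding S_def survival_def using fin that by (subst prod.remove[of _ x]) auto
  define g where "g t = (\<Sum>x\<in>U. S t - S' x t)" for t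
  have le: "S' x t \<le> S t" if "x \<in> U" "0 \<le> t" for x t
    unfolding S[OF that(1)] S'[OF that(1)] using that \<tau>
    by (intro mult_right_mono prod_nonneg erlang_tail_mono) (auto intro: erlang_tail_nonneg)
  have nonneg: "0 \<le> S t" "0 \<le> S' x t" if "0 \<le> t" for x t
    using that \<tau> by (auto simp: S_def S'_def survival_nonneg)
  have g_nonneg: "0 \<le> g t" if "0 \<le> t" for t
    unfolding g_def using le that by (intro sum_nonneg) auto
  have deriv: "((\<lambda>t. - S t) has_real_derivative g t) (at t)" for t
  proof -
    have *: "((\<lambda>t. erlang_tail (k - c x) (\<tau> x + t)) has_derivative
        (\<lambda>y. y * (erlang_tail (k - c x - 1) (\<tau> x + t) - erlang_tail (k - c x) (\<tau> x + t)))) (at t)"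
      if "x \<in> U" for x
    proof -
      have "k - c x > 0" using False that by auto
      from DERIV_erlang_tail[OF this, of "t + \<tau> x"]
      have "((\<lambda>t. erlang_tail (k - c x) (t + \<tau> x)) has_real_derivative
          (erlang_tail (k - c x - 1) (t + \<tau> x) - erlang_tail (k - c x) (t + \<tau> x))) (at t)"
        by (simp add: DERIV_shift)
      then show ?thesis
        unfolding has_field_derivative_def add.commute[of t] add.commute[of _ "\<tau> x"]
        by (rule has_derivative_eq_rhs) (simp add: fun_eq_iff)
    qed
    have "(S has_derivative (\<lambda>y. \<Sum>x\<in>U. y * (erlang_tail (k - c x - 1) (\<tau> x + t)
         - erlang_tail (k - c x) (\<tau> x + t)) * (\<Prod>u\<in>U-{x}. erlang_tail (k - c u) (\<tau> u + t)))) (at t)"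
      unfolding S_def survival_def using * by (rule has_derivative_prod)
    also have "(\<lambda>y. \<Sum>x\<in>U. y * (erlang_tail (k - c x - 1) (\<tau> x + t)
         - erlang_tail (k - c x) (\<tau> x + t)) * (\<Prod>u\<in>U-{x}. erlang_tail (k - c u) (\<tau> u + t)))
        = (*) (- g t)"
      by (auto simp: g_def fun_eq_iff sum_distrib_left sum_negf[symmetric] S S' left_diff_distrib
          algebra_simps intro!: sum.cong simp del: sum_negf)
    finally have "(S has_real_derivative - g t) (at t)"
      unfolding has_field_derivative_def .
    from DERIV_minus[OF this] show ?thesis by simp
  qed
  have eq: "of_nat (card ?C) * S t = (\<Sum>x\<in>?C. S' x t) + g t" for t
  proof -
    have "(\<Sum>x\<in>?C. S t - S' x t) = g t"
      unfolding g_def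
    proof (rule sum.mono_neutral_right[OF finite_root_component UC], intro ballI)
      fix x assume "x \<in> ?C - U"
      then have "S' x t = S t"
        unfolding S_def S'_def survival_def by (intro prod.cong) auto
      then show "S t - S' x t = 0" by simp
    qed
    then show ?thesis by (simp add: sum_subtractf)
  qed
  have [measurable]: "S \<in> borel_measurable borel" "S' x \<in> borel_measurable borel" for x
    by (auto simp: S_def S'_def)
  have [measurable]: "g \<in> borel_measurable borel"
    unfolding g_def by measurable
  have "(- S \<longlongrightarrow> - 0) at_top"
    unfolding S_def fun_Compl_def using U(2) fin \<tau> by (intro tendsto_minus) (auto intro: survival_tendsto_0)
  then have "(\<integral>\<^sup>+t\<in>{0..}. ennreal (g t) \<partial>lborel) = ennreal (0 - (- S 0))"
    by (intro nn_integral_FTC_atLeast deriv g_nonneg) (auto simp: fun_Compl_def)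
  then have g: "(\<integral>\<^sup>+t\<in>{0..}. ennreal (g t) \<partial>lborel) = ennreal (S 0)" by simp
  have "of_nat (card ?C) * (\<integral>\<^sup>+t\<in>{0..}. ennreal (S t) \<partial>lborel)
      = (\<integral>\<^sup>+t. of_nat (card ?C) * (ennreal (S t) * indicator {0..} t) \<partial>lborel)"
    by (rule nn_integral_cmult[symmetric]) measurable
  also have "\<dots> = (\<integral>\<^sup>+t. (\<Sum>x\<in>?C. ennreal (S' x t) * indicator {0..} t)
      + ennreal (g t) * indicator {0..} t \<partial>lborel)"
  proof (rule nn_integral_cong)
    fix t :: real
    have "of_nat (card ?C) * ennreal (S t) = (\<Sum>x\<in>?C. ennreal (S' x t)) + ennreal (g t)" if "0 \<le> t"
    proof -
      have "of_nat (card ?C) * ennreal (S t) = ennreal (of_nat (card ?C) * S t)"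
        using nonneg that by (simp add: ennreal_mult' ennreal_of_nat_eq_real_of_nat)
      then show ?thesis
        using nonneg g_nonneg that by (simp add: eq ennreal_plus sum_nonneg sum_ennreal)
    qed
    then show "of_nat (card ?C) * (ennreal (S t) * indicator {0..} t) =
        (\<Sum>x\<in>?C. ennreal (S' x t) * indicator {0..} t) + ennreal (g t) * indicator {0..} t"
      by (cases "0 \<le> t") auto
  qed
  also have "\<dots> = (\<Sum>x\<in>?C. \<integral>\<^sup>+t\<in>{0..}. ennreal (S' x t) \<partial>lborel) + ennreal (S 0)"
    by (simp add: nn_integral_add nn_integral_sum g)
  finally show ?thesis
    unfolding S_def S'_def .
qed

section \<open>First and second moments of the number of cuts\<close>

lemma root_path_nonempty: "root_path v \<noteq> {}"
  using self_in_path by blast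

lemma nn_integral_cuts_from_step:
  assumes "root \<in> remaining k c"
  shows "of_nat (card (root_component k c)) * (\<integral>\<^sup>+y. f y \<partial>cuts_from k c) =
    (\<Sum>x\<in>root_component k c. \<integral>\<^sup>+y. f (Suc y) \<partial>cuts_from k (c(x := Suc (c x))))"
proof -
  have ne: "root_component k c \<noteq> {}" and fin: "finite (root_component k c)"
    using root_in_root_component[OF assms] finite_root_component by auto
  then have "card (root_component k c) \<noteq> 0" by simp
  then have cancel: "of_nat (card (root_component k c)) * (a / of_nat (card (root_component k c))) = a" for a :: ennreal
    by (simp add: ennreal_times_divide mult_divide_eq_ennreal mult.commute)
  show ?thesis
    using assms ne fin
    by (subst cuts_from.simps)
      (simp add: nn_integral_pmf_of_set cancel ennreal_of_nat_eq_real_of_nat[symmetric] del: fun_upd_apply)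
qed

lemma card_root_component_cancel:
  assumes "root \<in> remaining k c"
    and "of_nat (card (root_component k c)) * a = of_nat (card (root_component k c)) * (b :: ennreal)"
  shows "a = b"
proof -
  have "card (root_component k c) \<noteq> 0"
    using root_in_root_component[OF assms(1)] finite_root_component by auto
  then show ?thesis
    using assms(2) by (auto simp: ennreal_mult_cancel_left)
qed

lemma set_pmf_root_component:
  "root \<in> remaining k c \<Longrightarrow> x \<in> root_component k c \<Longrightarrow> x \<in> set_pmf (pmf_of_set (root_component k c))"
  using root_in_root_component finite_root_component by (subst set_pmf_of_set) auto

lemma dead_on_path:
  assumes "v \<in> verts" "\<not> root_path v \<subseteq> remaining k c"
  obtains u where "u \<in> root_path v" "k \<le> c u"
proof -
  from assms(2) obtain u where "u \<in> root_path v" "u \<notin> remaining k c" by blast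
  with path_subset_verts[OF assms(1)] that show thesis
    by (auto simp: remaining_def not_less)
qed

lemma survival_at_0:
  assumes "v \<in> verts"
  shows "survival k c (root_path v) (\<lambda>_. 0) 0 = indicator (root_component k c) v"
proof (cases "v \<in> root_component k c")
  case True
  then have "k - c u \<noteq> 0" if "u \<in> root_path v" for u
    using that by (auto simp: root_component_eq remaining_def)
  then show ?thesis
    using True by (simp add: survival_def erlang_tail_at_0)
next
  case False
  then have "\<not> root_path v \<subseteq> remaining k c"
    using assms by (simp add: root_component_eq)
  then obtain u where "u \<in> root_path v" "k \<le> c u"
    using dead_on_path[OF assms] by metis
  then show ?thesis
    using False survival_eq_0[of "root_path v" u k c] finite_path assms by simp
qed

text \<open>
  Cuts occur at a rate equal to the size of the root component, so the expected number of cuts is the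
  expected size of the root component integrated over time. The proof only compares recursions: summed
  over \<open>v\<close>, the boundary terms of \<open>survival_balance\<close> count the root component, which is the
  \<open>+1\<close> per step of the procedure.
\<close>
lemma nn_integral_cuts_from:
  "(\<integral>\<^sup>+y. of_nat y \<partial>cuts_from k c) =
     (\<Sum>v\<in>verts. \<integral>\<^sup>+t\<in>{0..}. survival k c (root_path v) (\<lambda>_. 0) t \<partial>lborel)"
proof (induction k c rule: cuts_from.induct)
  case (1 k c)
  let ?C = "root_component k c" and ?c = "\<lambda>x. c(x := Suc (c x))"
  show ?case
  proof (cases "root \<in> remaining k c")
    case False
    then have "survival k c (root_path v) (\<lambda>_. 0) t = 0" if "v \<in> verts" for v t
      using survival_eq_0[of "root_path v" root k c] that finite_path root_in_path root_in_verts
      by (simp add: remaining_def not_less)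
    then show ?thesis
      using False by (subst cuts_from.simps) simp
  next
    case True
    have card_eq: "of_nat (card ?C) = (\<Sum>v\<in>verts. ennreal (survival k c (root_path v) (\<lambda>_. 0) 0))"
    proof -
      have "?C \<subseteq> verts" by (auto simp: root_component_eq)
      then show ?thesis
        by (simp add: survival_at_0 ennreal_indicator[symmetric] finite_verts sum.inter_restrict[symmetric]
           indicator_def if_distrib Int_absorb1 ennreal_of_nat_eq_real_of_nat cong: if_cong sum.cong)
    qed
    have "of_nat (card ?C) * (\<integral>\<^sup>+y. of_nat y \<partial>cuts_from k c) =
        (\<Sum>x\<in>?C. (\<Sum>v\<in>verts. \<integral>\<^sup>+t\<in>{0..}. survival k (?c x) (root_path v) (\<lambda>_. 0) t \<partial>lborel)) + of_nat (card ?C)"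
      using True 1[OF _ set_pmf_root_component]
      by (simp add: nn_integral_cuts_from_step nn_integral_add sum.distrib del: fun_upd_apply)
    also have "\<dots> = (\<Sum>v\<in>verts. (\<Sum>x\<in>?C. \<integral>\<^sup>+t\<in>{0..}. survival k (?c x) (root_path v) (\<lambda>_. 0) t \<partial>lborel)
        + ennreal (survival k c (root_path v) (\<lambda>_. 0) 0))"
      by (simp only: card_eq sum.distrib sum.swap[of _ verts ?C])
    also have "\<dots> = (\<Sum>v\<in>verts. of_nat (card ?C) * (\<integral>\<^sup>+t\<in>{0..}. survival k c (root_path v) (\<lambda>_. 0) t \<partial>lborel))"
    proof (intro sum.cong refl survival_balance[symmetric])
      show "root_path u \<subseteq> root_path v" if "v \<in> verts" "u \<in> root_path v" for u v
        using that by (rule path_trans)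
    qed (simp_all add: path_subset_verts root_path_nonempty)
    also have "\<dots> = of_nat (card ?C) * (\<Sum>v\<in>verts. \<integral>\<^sup>+t\<in>{0..}. survival k c (root_path v) (\<lambda>_. 0) t \<partial>lborel)"
      by (simp only: sum_distrib_left)
    finally show ?thesis
      by (rule card_root_component_cancel[OF True])
  qed
qed

text \<open>
  With these offsets the path of \<open>w\<close> is observed at a time \<open>s\<close> later than the rest of the path of \<open>v\<close>:
  a common ancestor present at the later time was also present at the earlier one.
\<close>
definition delay :: "'v \<Rightarrow> real \<Rightarrow> 'v \<Rightarrow> real" where
  "delay w s u = (if u \<in> root_path w then s else 0)"

text \<open>
  At the earlier time \<open>0\<close> the vertices off the path of \<open>w\<close> merely have to be present in state \<open>c\<close>,
  so the sum over \<open>v\<close> counts the current root component.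
\<close>
lemma sum_survival_at_0:
  assumes "w \<in> verts"
  shows "(\<Sum>v\<in>verts. survival k c (root_path v \<union> root_path w) (delay w s) 0) =
     of_nat (card (root_component k c)) * survival k c (root_path w) (\<lambda>_. 0) s"
proof (cases "root_path w \<subseteq> remaining k c")
  case False
  then obtain u where "u \<in> root_path w" "k \<le> c u"
    using dead_on_path[OF assms] by metis
  then show ?thesis
    using survival_eq_0[of _ u k c] finite_path assms by simp
next
  case True
  have "survival k c (root_path v \<union> root_path w) (delay w s) 0 =
      survival k c (root_path w) (\<lambda>_. 0) s * indicator (root_component k c) v" if "v \<in> verts" for v
  proof -
    have "survival k c (root_path v \<union> root_path w) (delay w s) 0 =
      survival k c (root_path w) (delay w s) 0 * survival k c (root_path v - root_path w) (delay w s) 0"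
      unfolding survival_def using finite_path assms that
      by (subst prod.union_disjoint[symmetric]) (auto intro!: prod.cong)
    also have "survival k c (root_path w) (delay w s) 0 = survival k c (root_path w) (\<lambda>_. 0) s"
      by (simp add: survival_def delay_def)
    also have "survival k c (root_path v - root_path w) (delay w s) 0 = survival k c (root_path v) (\<lambda>_. 0) 0"
      unfolding survival_def using finite_path[OF that] True
      by (intro prod.mono_neutral_cong_left) (auto simp: delay_def erlang_tail_at_0 remaining_def)
    finally show ?thesis
      using that by (simp add: survival_at_0)
  qed
  moreover have "root_component k c \<subseteq> verts" by (auto simp: root_component_eq)
  ultimately show ?thesis
    by (simp add: sum_distrib_left[symmetric] indicator_def finite_verts Int_absorb1 Int_def[symmetric]
        flip: sum.inter_restrict cong: if_cong sum.cong)
qed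

text \<open>
  The integral, over all pairs of times \<open>t \<le> s + t\<close>, of the probability that \<open>v\<close> belongs to the root
  component at time \<open>t\<close> and \<open>w\<close> at time \<open>s + t\<close>.
\<close>
definition pair_integral :: "nat \<Rightarrow> ('v \<Rightarrow> nat) \<Rightarrow> 'v \<Rightarrow> 'v \<Rightarrow> ennreal" where
  "pair_integral k c v w =
    (\<integral>\<^sup>+s\<in>{0..}. (\<integral>\<^sup>+t\<in>{0..}. survival k c (root_path v \<union> root_path w) (delay w s) t \<partial>lborel) \<partial>lborel)"

lemma measurable_survival_delay [measurable]:
  "(\<lambda>(s, t). survival k c U (delay w s) t) \<in> borel_measurable (borel \<Otimes>\<^sub>M borel)"
  unfolding survival_def delay_def by measurable

lemma pair_integral_balance:
  assumes "v \<in> verts" "w \<in> verts"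
  shows "of_nat (card (root_component k c)) * pair_integral k c v w =
    (\<Sum>x\<in>root_component k c. pair_integral k (c(x := Suc (c x))) v w) +
    (\<integral>\<^sup>+s\<in>{0..}. survival k c (root_path v \<union> root_path w) (delay w s) 0 \<partial>lborel)"
proof -
  let ?C = "root_component k c" and ?c = "\<lambda>x. c(x := Suc (c x))" and ?U = "root_path v \<union> root_path w"
  let ?I = "\<lambda>c s. \<integral>\<^sup>+t\<in>{0..}. survival k c ?U (delay w s) t \<partial>lborel"
  have [measurable]: "?I c \<in> borel_measurable borel" for c
    by measurable
  have [measurable]: "(\<lambda>s. survival k c ?U (delay w s) 0) \<in> borel_measurable borel"
    unfolding survival_def delay_def by measurable
  have "of_nat (card ?C) * pair_integral k c v w =
      (\<integral>\<^sup>+s\<in>{0..}. of_nat (card ?C) * ?I c s \<partial>lborel)"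
    unfolding pair_integral_def
    by (subst nn_integral_cmult[symmetric]) (auto simp: mult.assoc)
  also have "\<dots> = (\<integral>\<^sup>+s\<in>{0..}. ((\<Sum>x\<in>?C. ?I (?c x) s) + ennreal (survival k c ?U (delay w s) 0)) \<partial>lborel)"
  proof (intro nn_integral_cong)
    fix s :: real
    have "of_nat (card ?C) * ?I c s = (\<Sum>x\<in>?C. ?I (?c x) s) + ennreal (survival k c ?U (delay w s) 0)"
      if "0 \<le> s"
      using assms path_subset_verts path_trans self_in_path that
      by (intro survival_balance) (auto simp: delay_def, blast+)
    then show "of_nat (card ?C) * ?I c s * indicator {0..} s =
      ((\<Sum>x\<in>?C. ?I (?c x) s) + ennreal (survival k c ?U (delay w s) 0)) * indicator {0..} s"
      by (auto simp: indicator_def)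
  qed
  also have "\<dots> = (\<Sum>x\<in>?C. pair_integral k (?c x) v w) +
      (\<integral>\<^sup>+s\<in>{0..}. survival k c ?U (delay w s) 0 \<partial>lborel)"
    unfolding pair_integral_def
    by (simp add: distrib_right sum_distrib_right nn_integral_add nn_integral_sum del: fun_upd_apply)
  finally show ?thesis .
qed

text \<open>
  The rising factorial is the natural second moment here: it grows by \<open>2 * Suc y\<close> when \<open>y\<close> does by one,
  and the expectation of this increment is known from the first moment. On the other side, the
  boundary terms of the pair integrals reproduce the first moment by \<open>sum_survival_at_0\<close>.
\<close>
lemma nn_integral_cuts_from_rising:
  "(\<integral>\<^sup>+y. of_nat (y * Suc y) \<partial>cuts_from k c) = 2 * (\<Sum>v\<in>verts. \<Sum>w\<in>verts. pair_integral k c v w)"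
proof (induction k c rule: cuts_from.induct)
  case (1 k c)
  let ?C = "root_component k c" and ?c = "\<lambda>x. c(x := Suc (c x))"
  let ?H = "\<lambda>c. \<Sum>v\<in>verts. \<Sum>w\<in>verts. pair_integral k c v w"
  show ?case
  proof (cases "root \<in> remaining k c")
    case False
    then have "survival k c (root_path v \<union> root_path w) \<tau> t = 0" if "v \<in> verts" "w \<in> verts" for v w \<tau> t
      using survival_eq_0[of "root_path v \<union> root_path w" root k c] that finite_path root_in_path root_in_verts
      by (simp add: remaining_def not_less)
    then show ?thesis
      using False by (subst cuts_from.simps) (simp add: pair_integral_def)
  next
    case True
    have *: "of_nat (Suc y * Suc (Suc y)) = of_nat (y * Suc y) + 2 * (of_nat (Suc y) :: ennreal)" for y
    proof -
      have "Suc y * Suc (Suc y) = y * Suc y + 2 * Suc y" by simp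
      then show ?thesis by (simp only: of_nat_add of_nat_mult of_nat_numeral)
    qed
    have "of_nat (card ?C) * (\<integral>\<^sup>+y. of_nat (y * Suc y) \<partial>cuts_from k c) =
        (\<Sum>x\<in>?C. \<integral>\<^sup>+y. of_nat (y * Suc y) \<partial>cuts_from k (?c x)) +
        2 * (\<Sum>x\<in>?C. \<integral>\<^sup>+y. of_nat (Suc y) \<partial>cuts_from k (?c x))"
      unfolding nn_integral_cuts_from_step[OF True] *
      by (simp add: nn_integral_add nn_integral_cmult sum.distrib sum_distrib_left del: fun_upd_apply of_nat_Suc of_nat_mult mult_Suc_right)
    also have "(\<Sum>x\<in>?C. \<integral>\<^sup>+y. of_nat (Suc y) \<partial>cuts_from k (?c x)) =
        of_nat (card ?C) * (\<integral>\<^sup>+y. of_nat y \<partial>cuts_from k c)"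
      by (rule nn_integral_cuts_from_step[OF True, symmetric])
    also have "\<dots> = (\<Sum>v\<in>verts. \<Sum>w\<in>verts. \<integral>\<^sup>+s\<in>{0..}. survival k c (root_path v \<union> root_path w) (delay w s) 0 \<partial>lborel)"
    proof -
      have [measurable]: "(\<lambda>s. survival k c U (delay w s) 0) \<in> borel_measurable borel" for U w
        unfolding survival_def delay_def by measurable
      have "of_nat (card ?C) * (\<integral>\<^sup>+s\<in>{0..}. survival k c (root_path w) (\<lambda>_. 0) s \<partial>lborel) =
        (\<Sum>v\<in>verts. \<integral>\<^sup>+s\<in>{0..}. survival k c (root_path v \<union> root_path w) (delay w s) 0 \<partial>lborel)" if "w \<in> verts" for w
      proof -
        have "of_nat (card ?C) * (\<integral>\<^sup>+s\<in>{0..}. survival k c (root_path w) (\<lambda>_. 0) s \<partial>lborel) =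
          (\<integral>\<^sup>+s\<in>{0..}. ennreal (\<Sum>v\<in>verts. survival k c (root_path v \<union> root_path w) (delay w s) 0) \<partial>lborel)"
          by (simp add: sum_survival_at_0[OF that] ennreal_mult' ennreal_of_nat_eq_real_of_nat
            nn_integral_cmult[symmetric] mult.assoc)
        also have "\<dots> = (\<integral>\<^sup>+s. (\<Sum>v\<in>verts. ennreal (survival k c (root_path v \<union> root_path w) (delay w s) 0) * indicator {0..} s) \<partial>lborel)"
        proof (intro nn_integral_cong)
          fix s :: real
          have "0 \<le> survival k c (root_path v \<union> root_path w) (delay w s) 0" if "0 \<le> s" for v
            using that by (intro survival_nonneg) (simp_all add: delay_def)
          then show "ennreal (\<Sum>v\<in>verts. survival k c (root_path v \<union> root_path w) (delay w s) 0) * indicator {0..} s =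
              (\<Sum>v\<in>verts. ennreal (survival k c (root_path v \<union> root_path w) (delay w s) 0) * indicator {0..} s)"
            by (cases "0 \<le> s") simp_all
        qed
        also have "\<dots> = (\<Sum>v\<in>verts. \<integral>\<^sup>+s\<in>{0..}. survival k c (root_path v \<union> root_path w) (delay w s) 0 \<partial>lborel)"
          by (rule nn_integral_sum) measurable
        finally show ?thesis .
      qed
      then show ?thesis
        unfolding nn_integral_cuts_from sum_distrib_left by (subst sum.swap) simp
    qed
    also have "(\<Sum>x\<in>?C. \<integral>\<^sup>+y. of_nat (y * Suc y) \<partial>cuts_from k (?c x)) = (\<Sum>x\<in>?C. 2 * ?H (?c x))"
      using 1[OF _ set_pmf_root_component] True by (intro sum.cong refl) (simp del: fun_upd_apply)
    also have "\<dots> = 2 * (\<Sum>v\<in>verts. \<Sum>w\<in>verts. \<Sum>x\<in>?C. pair_integral k (?c x) v w)"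
      by (simp add: sum_distrib_left[symmetric] sum.swap[of _ _ ?C] del: fun_upd_apply)
    also have "\<dots> + 2 * (\<Sum>v\<in>verts. \<Sum>w\<in>verts. \<integral>\<^sup>+s\<in>{0..}. survival k c (root_path v \<union> root_path w) (delay w s) 0 \<partial>lborel)
       = 2 * (\<Sum>v\<in>verts. \<Sum>w\<in>verts. of_nat (card ?C) * pair_integral k c v w)"
      by (simp add: pair_integral_balance distrib_left[symmetric] sum.distrib[symmetric] del: fun_upd_apply cong: sum.cong)
    also have "\<dots> = of_nat (card ?C) * (2 * ?H c)"
      by (simp add: sum_distrib_left mult.left_commute)
    finally show ?thesis
      by (rule card_root_component_cancel[OF True])
  qed
qed

end

section \<open>Asymptotics of integrals of powers of Erlang tails\<close>

lemma erlang_tail_bounds: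
  assumes "0 \<le> t"
  shows "1 - t ^ k / fact k \<le> erlang_tail k t"
    and "erlang_tail k t \<le> 1 - exp (- (2 * t)) * (t ^ k / fact k)"
proof -
  obtain x where x: "\<bar>x\<bar> \<le> \<bar>t\<bar>" "exp t = (\<Sum>m<k. t ^ m / fact m) + exp x / fact k * t ^ k"
    using Maclaurin_exp_le by blast
  have "erlang_tail k t = exp (- t) * (exp t - exp x / fact k * t ^ k)"
    unfolding erlang_tail_def using x(2) by simp
  also have "\<dots> = 1 - exp (x - t) * (t ^ k / fact k)"
    by (simp add: right_diff_distrib exp_diff exp_minus field_simps)
  finally have eq: "erlang_tail k t = 1 - exp (x - t) * (t ^ k / fact k)" .
  have "exp (x - t) * (t ^ k / fact k) \<le> 1 * (t ^ k / fact k)"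
    using x(1) assms by (intro mult_right_mono) auto
  then show "1 - t ^ k / fact k \<le> erlang_tail k t"
    unfolding eq by simp
  have "exp (- (2 * t)) * (t ^ k / fact k) \<le> exp (x - t) * (t ^ k / fact k)"
    using x(1) assms by (intro mult_right_mono) auto
  then show "erlang_tail k t \<le> 1 - exp (- (2 * t)) * (t ^ k / fact k)"
    unfolding eq by simp
qed

lemma erlang_tail_exp_bound_small:
  assumes "0 \<le> t" "t \<le> 1"
  shows "erlang_tail k t \<le> exp (- (exp (- 2) / fact k) * t ^ k)"
proof -
  have "erlang_tail k t \<le> 1 - exp (- (2 * t)) * (t ^ k / fact k)"
    by (rule erlang_tail_bounds) fact
  also have "\<dots> \<le> 1 - exp (- 2) * (t ^ k / fact k)"
    using assms by (intro diff_left_mono mult_right_mono) auto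
  also have "\<dots> \<le> exp (- (exp (- 2) * (t ^ k / fact k)))"
    using exp_ge_add_one_self[of "- (exp (- 2) * (t ^ k / fact k))"] by simp
  finally show ?thesis by (simp add: field_simps)
qed

text \<open>
  It suffices to have \<open>(\<Sum>j<k. t ^ j / fact j) \<le> exp (l * t)\<close> for some \<open>l < 1\<close>. For \<open>l\<close> close to one,
  the terms of degree below \<open>k\<close> that \<open>exp (l * t)\<close> loses against \<open>exp t\<close> are compensated by its
  own term of degree \<open>k\<close>.
\<close>
lemma erlang_tail_exp_bound_large:
  assumes "k > 0"
  obtains \<delta> where "\<delta> > 0" "\<And>t. 1 \<le> t \<Longrightarrow> erlang_tail k t \<le> exp (- \<delta> * t)"
proof -
  \<comment> \<open>Chosen such that \<open>k * (1 - y) = y / fact k\<close>, the balance of loss and gain for \<open>l ^ k = y\<close>.\<close>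
  define y :: real where "y = k / (k + 1 / fact k)"
  define l where "l = root k y"
  have y: "0 < y" "y < 1"
    using assms by (auto simp: y_def field_simps add_pos_pos)
  have "k + 1 / fact k > (0::real)"
    using assms by (simp add: add_pos_pos)
  then have "y * (k + 1 / fact k) = k"
    by (simp add: y_def)
  then have y_eq: "k * (1 - y) = y / fact k"
    by (simp add: algebra_simps)
  have l: "0 < l" "l < 1" and ly: "l ^ k = y"
    using assms y by (auto simp: l_def)
  have "erlang_tail k t \<le> exp (- (1 - l) * t)" if t: "1 \<le> t" for t
  proof -
    have "(\<Sum>j<k. t ^ j / fact j) - (\<Sum>j<k. (l * t) ^ j / fact j) = (\<Sum>j<k. (1 - l ^ j) * (t ^ j / fact j))"
      by (simp add: sum_subtractf[symmetric] left_diff_distrib diff_divide_distrib power_mult_distrib)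
    also have "\<dots> \<le> (\<Sum>j<k. (1 - y) * (t ^ k / 1))"
    proof (intro sum_mono mult_mono frac_le)
      fix j assume "j \<in> {..<k}"
      then have j: "j \<le> k" by simp
      show "1 - l ^ j \<le> 1 - y"
        using power_decreasing[OF j, of l] l by (simp add: ly)
      show "t ^ j \<le> t ^ k"
        using t j by (rule power_increasing[rotated])
    qed (use t y in auto)
    also have "\<dots> = (k * (1 - y)) * t ^ k" by simp
    also have "\<dots> = (l * t) ^ k / fact k"
      unfolding y_eq by (simp add: power_mult_distrib ly)
    finally have "(\<Sum>j<k. t ^ j / fact j) \<le> (\<Sum>j<Suc k. (l * t) ^ j / fact j)"
      by simp
    also have "\<dots> \<le> exp (l * t)"
      using sum_le_suminf[OF summable_exp[of "l * t"], of "{..<Suc k}"] l t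
      by (simp add: exp_def scaleR_conv_of_real divide_inverse mult.commute del: sum.lessThan_Suc)
    finally have "erlang_tail k t \<le> exp (- t) * exp (l * t)"
      unfolding erlang_tail_def by (intro mult_left_mono) auto
    also have "\<dots> = exp (- (1 - l) * t)"
      by (simp add: exp_add[symmetric] algebra_simps)
    finally show ?thesis .
  qed
  with l that[of "1 - l"] show thesis by simp
qed

text \<open>
  A dominating function, independent of \<open>a\<close>, on the scale \<open>a powr (- 1 / k)\<close> on which the \<open>a\<close>-th
  power of the tail decays.
\<close>
lemma scaled_erlang_tail_bound:
  assumes "k > 0"
  obtains \<delta> where "\<delta> > 0"
    "\<And>a s. a > 0 \<Longrightarrow> 0 \<le> s \<Longrightarrow> erlang_tail k (real a powr (- 1 / k) * s) ^ a \<le> exp \<delta> * exp (- \<delta> * s)"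
proof -
  obtain \<delta>' where \<delta>': "\<delta>' > 0" "\<And>t. 1 \<le> t \<Longrightarrow> erlang_tail k t \<le> exp (- \<delta>' * t)"
    using erlang_tail_exp_bound_large[OF assms] by blast
  define \<delta> where "\<delta> = min \<delta>' (exp (- 2) / fact k)"
  have \<delta>: "\<delta> > 0" "\<delta> \<le> \<delta>'" "\<delta> \<le> exp (- 2) / fact k"
    using \<delta>' by (auto simp: \<delta>_def)
  have "erlang_tail k (real a powr (- 1 / k) * s) ^ a \<le> exp \<delta> * exp (- \<delta> * s)" if a: "a > 0" and s: "0 \<le> s" for a s
  proof -
    define t where "t = real a powr (- 1 / k) * s"
    have t: "0 \<le> t" using s by (simp add: t_def)
    show ?thesis
    \<comment> \<open>The tail decays like \<open>exp (- \<delta> * t)\<close> for large \<open>t\<close> and like \<open>exp (- \<delta> * t ^ k)\<close> for small \<open>t\<close>.\<close>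
    proof (cases "1 \<le> t")
      case True
      have "erlang_tail k t \<le> exp (- \<delta> * t)"
        using \<delta>'(2)[OF True] \<delta> t by (smt (verit) exp_le_cancel_iff mult_right_mono)
      then have "erlang_tail k t ^ a \<le> exp (- \<delta> * t) ^ a"
        using t by (intro power_mono erlang_tail_nonneg)
      also have "\<dots> = exp (- \<delta> * (a * t))"
        by (simp add: exp_of_nat_mult[symmetric] algebra_simps)
      also have "\<dots> \<le> exp (- \<delta> * s)"
      proof -
        have "real a * t = real a powr (1 - 1 / k) * s"
          using a by (simp add: t_def powr_diff powr_minus field_simps)
        also have "\<dots> \<ge> 1 * s"
          using a assms s by (intro mult_right_mono ge_one_powr_ge_zero) (auto simp: field_simps)
        finally show ?thesis using \<delta> by simp
      qed
      also have "\<dots> \<le> exp \<delta> * exp (- \<delta> * s)"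
        using \<delta> by simp
      finally show ?thesis by (simp add: t_def)
    next
      case False
      have "erlang_tail k t \<le> exp (- (exp (- 2) / fact k) * t ^ k)"
        using False t by (intro erlang_tail_exp_bound_small) auto
      also have "\<dots> \<le> exp (- \<delta> * t ^ k)"
        using mult_right_mono[OF \<delta>(3), of "t ^ k"] t by simp
      finally have "erlang_tail k t ^ a \<le> exp (- \<delta> * t ^ k) ^ a"
        using t by (intro power_mono erlang_tail_nonneg)
      also have "\<dots> = exp (- \<delta> * (a * t ^ k))"
        by (simp add: exp_of_nat_mult[symmetric] algebra_simps)
      also have "a * t ^ k = s ^ k"
      proof -
        have "(real a powr (- 1 / k)) ^ k = real a powr (- 1 / k * k)"
          using a by (simp add: powr_power)
        also have "\<dots> = 1 / a"
          using a assms by (simp add: powr_minus_divide)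
        finally show ?thesis
          using a by (simp add: t_def power_mult_distrib)
      qed
      also have "exp (- \<delta> * s ^ k) \<le> exp (- \<delta> * (s - 1))"
      proof -
        have "s - 1 \<le> s ^ k"
          using s assms by (cases "s \<le> 1") (auto intro: order_trans[OF _ self_le_power] order_trans[OF _ zero_le_power])
        then show ?thesis using \<delta> by simp
      qed
      also have "\<dots> = exp \<delta> * exp (- \<delta> * s)"
        by (simp add: exp_add[symmetric] algebra_simps)
      finally show ?thesis by (simp add: t_def)
    qed
  qed
  with \<delta>(1) that show thesis by blast
qed

lemma nn_integral_exp_minus:
  assumes "\<delta> > (0::real)"
  shows "(\<integral>\<^sup>+t\<in>{0..}. ennreal (exp (- \<delta> * t)) \<partial>lborel) = ennreal (1 / \<delta>)"
proof -
  have "(\<integral>\<^sup>+t\<in>{0..}. ennreal (exp (- \<delta> * t)) \<partial>lborel) = ennreal (0 - (- exp (- \<delta> * 0) / \<delta>))"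
  proof (rule nn_integral_FTC_atLeast)
    show "((\<lambda>t. - exp (- \<delta> * t) / \<delta>) has_real_derivative exp (- \<delta> * t)) (at t)" for t
      using assms by (auto intro!: derivative_eq_intros)
    show "((\<lambda>t. - exp (- \<delta> * t) / \<delta>) \<longlongrightarrow> 0) at_top"
      using assms by real_asymp
  qed auto
  then show ?thesis by simp
qed

lemma integrable_exp_minus:
  assumes "\<delta> > (0::real)"
  shows "integrable lborel (\<lambda>t. indicator {0..} t * exp (- \<delta> * t))"
proof (rule integrableI_nonneg)
  have "(\<integral>\<^sup>+t. ennreal (indicator {0..} t * exp (- \<delta> * t)) \<partial>lborel) = 
    (\<integral>\<^sup>+t\<in>{0..}. ennreal (exp (- \<delta> * t)) \<partial>lborel)"
    by (intro nn_integral_cong) (auto simp: indicator_def)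
  also have "\<dots> < \<infinity>"
    unfolding nn_integral_exp_minus[OF assms] by simp
  finally show "(\<integral>\<^sup>+t. ennreal (indicator {0..} t * exp (- \<delta> * t)) \<partial>lborel) < \<infinity>" .
qed auto

text \<open>
  The expected time during which a vertex with \<open>a - 1\<close> proper ancestors belongs to the root component,
  which is its contribution to the expected number of cuts.
\<close>
definition tail_integral :: "nat \<Rightarrow> nat \<Rightarrow> real" where
  "tail_integral k a = (\<integral>t. indicator {0..} t * erlang_tail k t ^ a \<partial>lborel)"

lemma integrable_erlang_tail_power:
  assumes "k > 0" "a > 0"
  shows "integrable lborel (\<lambda>t. indicator {0..} t * erlang_tail k t ^ a)"
proof -
  obtain \<delta> where \<delta>: "\<delta> > 0"
    "\<And>a s. a > 0 \<Longrightarrow> 0 \<le> s \<Longrightarrow> erlang_tail k (real a powr (- 1 / k) * s) ^ a \<le> exp \<delta> * exp (- \<delta> * s)"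
    using scaled_erlang_tail_bound[OF assms(1)] by blast
  have 1: "integrable lborel (\<lambda>t. exp \<delta> * (indicator {0..} t * exp (- \<delta> * t)))"
    by (intro integrable_mult_right integrable_exp_minus \<delta>)
  show ?thesis
  proof (rule Bochner_Integration.integrable_bound[OF 1])
    have "erlang_tail k t ^ a \<le> exp \<delta> * exp (- \<delta> * t)" if "0 \<le> t" for t
    proof -
      have "erlang_tail k t ^ a \<le> erlang_tail k t ^ 1"
        using assms(2) that by (intro power_decreasing erlang_tail_nonneg erlang_tail_le_1) auto
      with \<delta>(2)[of 1 t] that show ?thesis by simp
    qed
    then show "AE t in lborel. norm (indicator {0..} t * erlang_tail k t ^ a)
        \<le> norm (exp \<delta> * (indicator {0..} t * exp (- \<delta> * t)))"
      by (auto simp: indicator_def erlang_tail_nonneg)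
  qed measurable
qed

lemma nn_integral_erlang_tail_power:
  assumes "k > 0" "a > 0"
  shows "(\<integral>\<^sup>+t\<in>{0..}. ennreal (erlang_tail k t ^ a) \<partial>lborel) = ennreal (tail_integral k a)"
proof -
  have "(\<integral>\<^sup>+t\<in>{0..}. ennreal (erlang_tail k t ^ a) \<partial>lborel) =
    (\<integral>\<^sup>+t. ennreal (indicator {0..} t * erlang_tail k t ^ a) \<partial>lborel)"
    by (intro nn_integral_cong) (auto simp: indicator_def)
  also have "\<dots> = ennreal (tail_integral k a)"
    unfolding tail_integral_def
    by (intro nn_integral_eq_integral integrable_erlang_tail_power assms) (auto simp: indicator_def erlang_tail_nonneg)
  finally show ?thesis .
qed

text \<open>
  The substitution \<open>u = s ^ k / fact k\<close> turns the integral into that of the gamma function at \<open>1 / k\<close>.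
\<close>
lemma integral_exp_minus_power:
  assumes "k > 0"
  shows "(\<integral>s. indicator {0..} s * exp (- (s ^ k / fact k)) \<partial>lborel) =
    fact k powr (1 / real k) * Gamma (1 + 1 / real k)"
proof -
  define f where "f = (\<lambda>u::real. u powr (1 / k - 1) / exp u)"
  define g where "g = (\<lambda>s::real. s ^ k / fact k)"
  define g' where "g' = (\<lambda>s::real. k * s ^ (k - 1) / fact k)"
  let ?S = "{0<..} :: real set"
  define C where "C = fact k powr (1 / real k) / k"
  have C: "C > 0" using assms by (simp add: C_def)
  have im: "g ` ?S = ?S"
  proof (intro set_eqI iffI)
    fix u :: real assume u: "u \<in> ?S"
    then have "u = g (root k (u * fact k))" "root k (u * fact k) \<in> ?S"
      using assms by (auto simp: g_def)
    then show "u \<in> g ` ?S" by blast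
  qed (auto simp: g_def)
  have inj: "inj_on g ?S"
    using assms by (auto simp: inj_on_def g_def power_eq_iff_eq_base)
  have f: "(f has_integral Gamma (1 / k)) ?S" "f absolutely_integrable_on ?S"
  proof -
    have "(f has_integral Gamma (1 / k)) {0..}"
      unfolding f_def using assms by (intro Gamma_integral_real) simp
    then show "(f has_integral Gamma (1 / k)) ?S"
      by (subst has_integral_spike_set_eq[of _ "{0..}"]) (auto intro: negligible_subset[of "{0}"])
    then show "f absolutely_integrable_on ?S"
      by (intro nonnegative_absolutely_integrable_1) (auto simp: f_def)
  qed
  have subst: "(\<lambda>x. \<bar>g' x\<bar> * f (g x)) absolutely_integrable_on ?S \<and>
      integral ?S (\<lambda>x. \<bar>g' x\<bar> * f (g x)) = Gamma (1 / k)"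
  proof (subst has_absolute_integral_change_of_variables_1'[where g = g and g' = g'])
    show "(g has_real_derivative g' x) (at x within ?S)" for x
      unfolding g_def g'_def by (auto intro!: derivative_eq_intros)
  qed (use f inj im in \<open>auto simp: integral_unique\<close>)
  have eq: "\<bar>g' x\<bar> * f (g x) = exp (- (x ^ k / fact k)) / C" if "x \<in> ?S" for x
  proof -
    have x: "x > 0" using that by simp
    have "g x powr (1 / k - 1) = x powr (k * (1 / k - 1)) / fact k powr (1 / k - 1)"
      using x by (simp add: g_def powr_divide powr_realpow[symmetric] powr_powr del: powr_realpow)
    also have "k * (1 / k - 1) = - real (k - 1)"
      using assms by (simp add: right_diff_distrib of_nat_diff)
    also have "x powr \<dots> = 1 / x ^ (k - 1)"
      using x by (simp only: powr_minus_divide powr_realpow)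
    also have "fact k powr (1 / k - 1) = fact k powr (1 / k) / (fact k :: real)"
      by (simp add: powr_diff)
    finally have "g x powr (1 / k - 1) = 1 / x ^ (k - 1) / (fact k powr (1 / k) / fact k)" .
    then show ?thesis
      using x assms by (simp add: f_def g'_def C_def g_def exp_minus field_simps)
  qed
  have abs: "(\<lambda>s. exp (- (s ^ k / fact k)) / C) absolutely_integrable_on ?S"
    using subst eq by (subst (asm) set_integrable_cong[OF refl refl eq]) auto
  have "integral ?S (\<lambda>s. exp (- (s ^ k / fact k)) / C) = Gamma (1 / k)"
    using subst Henstock_Kurzweil_Integration.integral_cong[OF eq, of ?S] by auto
  then have int: "integral ?S (\<lambda>s. exp (- (s ^ k / fact k))) = C * Gamma (1 / k)"
    using C by (simp add: field_simps)
  have "set_integrable lborel ?S (\<lambda>s. exp (- (s ^ k / fact k)) / C)"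
    using abs unfolding set_integrable_def by (subst (asm) integrable_completion) auto
  then have "set_integrable lborel ?S (\<lambda>s. C * (exp (- (s ^ k / fact k)) / C))"
    by (intro set_integrable_mult_right)
  then have "set_integrable lborel ?S (\<lambda>s. exp (- (s ^ k / fact k)))"
    using C by simp
  then have "(LINT s:?S|lborel. exp (- (s ^ k / fact k))) = C * Gamma (1 / k)"
    using int by (simp add: set_borel_integral_eq_integral)
  moreover have "(\<integral>s. indicator {0..} s * exp (- (s ^ k / fact k)) \<partial>lborel) =
      (LINT s:?S|lborel. exp (- (s ^ k / fact k)))"
    unfolding set_lebesgue_integral_def
  proof (rule integral_cong_AE)
    show "AE s in lborel. indicator {0..} s * exp (- (s ^ k / fact k)) = indicat_real ?S s *\<^sub>R exp (- (s ^ k / fact k))"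
      using AE_lborel_singleton[of 0] by eventually_elim (auto simp: indicator_def)
  qed auto
  moreover have "1 / real k \<notin> \<int>\<^sub>\<le>\<^sub>0"
    using assms nonpos_Ints_nonpos[of "1 / real k"] by force
  then have "Gamma (1 + 1 / real k) = 1 / k * Gamma (1 / k)"
    using Gamma_plus1[of "1 / real k"] assms by (simp add: add.commute)
  ultimately show ?thesis
    by (simp add: C_def)
qed

lemma scaled_erlang_tail_limit:
  assumes "k > 0" "0 \<le> s"
  shows "(\<lambda>a. erlang_tail k (real a powr (- 1 / k) * s) ^ a) \<longlonglongrightarrow> exp (- (s ^ k / fact k))"
proof (rule tendsto_sandwich)
  define t where "t a = real a powr (- 1 / k) * s" for a
  have t: "0 \<le> t a" for a using assms by (simp add: t_def)
  have tk: "t a ^ k / fact k = s ^ k / fact k / a" if "a > 0" for a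
    using that assms by (simp add: t_def power_mult_distrib powr_realpow[symmetric] powr_powr powr_minus field_simps del: powr_realpow)
  have t0: "t \<longlonglongrightarrow> 0"
    unfolding t_def using assms by real_asymp
  have "\<forall>\<^sub>F a in sequentially. real a \<ge> s ^ k / fact k"
    by real_asymp
  then show "\<forall>\<^sub>F a in sequentially. (1 + - (s ^ k / fact k) / a) ^ a \<le> erlang_tail k (real a powr (- 1 / k) * s) ^ a"
    using eventually_gt_at_top[of 0]
  proof eventually_elim
    case (elim a)
    have "1 + - (s ^ k / fact k) / a \<le> erlang_tail k (t a)"
      using erlang_tail_bounds(1)[OF t, of a k] tk[of a] elim by simp
    moreover have "0 \<le> 1 + - (s ^ k / fact k) / a"
      using elim by (simp add: field_simps)
    ultimately show ?case
      unfolding t_def by (intro power_mono)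
  qed
  show "(\<lambda>a. (1 + - (s ^ k / fact k) / real a) ^ a) \<longlonglongrightarrow> exp (- (s ^ k / fact k))"
    by (rule tendsto_exp_limit_sequentially)
  show "\<forall>\<^sub>F a in sequentially. erlang_tail k (real a powr (- 1 / k) * s) ^ a \<le> exp (- (exp (- (2 * t a)) * (s ^ k / fact k)))"
    using eventually_gt_at_top[of 0]
  proof eventually_elim
    case (elim a)
    let ?x = "exp (- (2 * t a)) * (t a ^ k / fact k)"
    have "erlang_tail k (t a) \<le> exp (- ?x)"
      using erlang_tail_bounds(2)[OF t, of k a] exp_ge_add_one_self[of "- ?x"] by linarith
    then have "erlang_tail k (t a) ^ a \<le> exp (- ?x) ^ a"
      using t by (intro power_mono erlang_tail_nonneg)
    also have "\<dots> = exp (- (exp (- (2 * t a)) * (s ^ k / fact k)))"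
      using elim by (simp add: exp_of_nat_mult[symmetric] tk)
    finally show ?case unfolding t_def .
  qed
  have "(\<lambda>a. exp (- (exp (- (2 * t a)) * (s ^ k / fact k)))) \<longlonglongrightarrow> exp (- (exp (- (2 * 0)) * (s ^ k / fact k)))"
    by (intro tendsto_intros t0)
  then show "(\<lambda>a. exp (- (exp (- (2 * t a)) * (s ^ k / fact k)))) \<longlonglongrightarrow> exp (- (s ^ k / fact k))"
    by simp
qed

text \<open>
  After the substitution \<open>t = a powr (- 1 / k) * s\<close> the integrands converge, because
  \<open>erlang_tail k t = 1 - t ^ k / fact k * (1 + o(1))\<close> for small \<open>t\<close>, and they are dominated.
\<close>
lemma tail_integral_asymptotics:
  assumes "k > 0"
  shows "(\<lambda>a. real a powr (1 / k) * tail_integral k a) \<longlonglongrightarrow> fact k powr (1 / k) * Gamma (1 + 1 / k)"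
proof -
  define F where "F a s = indicator {0..} s * erlang_tail k (real a powr (- 1 / k) * s) ^ a" for a s
  obtain \<delta> where \<delta>: "\<delta> > 0"
    "\<And>a s. a > 0 \<Longrightarrow> 0 \<le> s \<Longrightarrow> erlang_tail k (real a powr (- 1 / k) * s) ^ a \<le> exp \<delta> * exp (- \<delta> * s)"
    using scaled_erlang_tail_bound[OF assms] by blast
  have "(\<lambda>a. \<integral>s. F (Suc a) s \<partial>lborel) \<longlonglongrightarrow> (\<integral>s. indicator {0..} s * exp (- (s ^ k / fact k)) \<partial>lborel)"
  proof (rule integral_dominated_convergence)
    show "integrable lborel (\<lambda>s. exp \<delta> * (indicator {0..} s * exp (- \<delta> * s)))"
      by (intro integrable_mult_right integrable_exp_minus \<delta>)
    have "(\<lambda>a. F a s) \<longlonglongrightarrow> indicator {0..} s * exp (- (s ^ k / fact k))" for s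
      unfolding F_def using scaled_erlang_tail_limit[OF assms, of s]
      by (cases "0 \<le> s") (auto simp: indicator_def)
    then show "AE s in lborel. (\<lambda>a. F (Suc a) s) \<longlonglongrightarrow> indicator {0..} s * exp (- (s ^ k / fact k))"
      by (intro AE_I2 LIMSEQ_Suc)
    have "norm (F (Suc a) s) \<le> exp \<delta> * (indicator {0..} s * exp (- \<delta> * s))" for a s
      unfolding F_def using \<delta>(2)[of "Suc a" s]
      by (auto simp: indicator_def erlang_tail_nonneg simp del: of_nat_Suc power_Suc)
    then show "AE s in lborel. norm (F (Suc a) s) \<le> exp \<delta> * (indicator {0..} s * exp (- \<delta> * s))" for a
      by simp
  qed (simp_all add: F_def)
  moreover have "(\<integral>s. F a s \<partial>lborel) = real a powr (1 / k) * tail_integral k a" if "a > 0" for a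
  proof -
    define r where "r = real a powr (- 1 / k)"
    have r: "r > 0" using that by (simp add: r_def)
    have "tail_integral k a = \<bar>r\<bar> *\<^sub>R (\<integral>s. indicator {0..} (0 + r * s) * erlang_tail k (0 + r * s) ^ a \<partial>lborel)"
      unfolding tail_integral_def using r by (intro lborel_integral_real_affine) simp
    also have "(\<lambda>s. indicator {0..} (0 + r * s) * erlang_tail k (0 + r * s) ^ a) = F a"
      using r by (auto simp: F_def r_def indicator_def fun_eq_iff zero_le_mult_iff)
    finally show ?thesis
      using r that by (simp add: r_def powr_minus)
  qed
  ultimately have "(\<lambda>a. real (Suc a) powr (1 / k) * tail_integral k (Suc a)) \<longlonglongrightarrow> fact k powr (1 / k) * Gamma (1 + 1 / k)"
    by (simp add: integral_exp_minus_power[OF assms] del: of_nat_Suc)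
  then show ?thesis
    by (rule LIMSEQ_imp_Suc)
qed

lemma erlang_tail_exp_bound:
  assumes "k > 0"
  obtains \<delta> where "\<delta> > 0" "\<And>t. 0 \<le> t \<Longrightarrow> erlang_tail k t \<le> exp \<delta> * exp (- \<delta> * t)"
proof -
  obtain \<delta> where "\<delta> > 0"
    "\<And>a s. a > 0 \<Longrightarrow> 0 \<le> s \<Longrightarrow> erlang_tail k (real a powr (- 1 / k) * s) ^ a \<le> exp \<delta> * exp (- \<delta> * s)"
    using scaled_erlang_tail_bound[OF assms] by blast
  from this(1) this(2)[of 1] that show thesis by simp
qed

lemma tail_integral_antimono:
  assumes "k > 0" "0 < a" "a \<le> b"
  shows "tail_integral k b \<le> tail_integral k a"
  unfolding tail_integral_def
proof (rule integral_mono)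
  show "indicator {0..} t * erlang_tail k t ^ b \<le> indicator {0..} t * erlang_tail k t ^ a" for t :: real
    using assms by (auto simp: indicator_def erlang_tail_nonneg erlang_tail_le_1 power_decreasing)
qed (use assms in \<open>auto intro: integrable_erlang_tail_power\<close>)

lemma tail_integral_nonneg: "0 \<le> tail_integral k a"
  unfolding tail_integral_def by (rule integral_nonneg_AE) (auto simp: indicator_def erlang_tail_nonneg)

section \<open>Bounds for pairs of vertices\<close>

text \<open>
  The left-hand side integrates over the pairs of times \<open>t \<le> s + t\<close>, one half of the quadrant.
\<close>
lemma nn_integral_symmetric_pair:
  fixes f :: "real \<Rightarrow> ennreal"
  assumes [measurable]: "f \<in> borel_measurable borel"
  shows "2 * (\<integral>\<^sup>+s\<in>{0..}. (\<integral>\<^sup>+t\<in>{0..}. f t * f (s + t) \<partial>lborel) \<partial>lborel) =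
    (\<integral>\<^sup>+t\<in>{0..}. f t \<partial>lborel)\<^sup>2"
proof -
  define g where "g t = f t * indicator {0..} t" for t
  have [measurable]: "g \<in> borel_measurable borel" unfolding g_def by measurable
  let ?X = "\<integral>\<^sup>+t. (\<integral>\<^sup>+u. g t * g u * indicator {t..} u \<partial>lborel) \<partial>lborel"
  have m: "(\<lambda>(t, u). g t * g u * indicator {t..} u) \<in> borel_measurable (lborel \<Otimes>\<^sub>M lborel)"
    unfolding indicator_def atLeast_iff by measurable
  have m': "(\<lambda>(s, t). g t * g (s + t) * indicator {0..} s) \<in> borel_measurable (lborel \<Otimes>\<^sub>M lborel)"
    by measurable
  have "(\<integral>\<^sup>+s\<in>{0..}. (\<integral>\<^sup>+t\<in>{0..}. f t * f (s + t) \<partial>lborel) \<partial>lborel) =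
    (\<integral>\<^sup>+s. (\<integral>\<^sup>+t. g t * g (s + t) * indicator {0..} s \<partial>lborel) \<partial>lborel)"
    by (intro nn_integral_cong, subst nn_integral_multc[symmetric])
      (auto simp: g_def indicator_def intro!: nn_integral_cong)
  also have "\<dots> = (\<integral>\<^sup>+t. (\<integral>\<^sup>+s. g t * g (s + t) * indicator {0..} s \<partial>lborel) \<partial>lborel)"
    using lborel_pair.Fubini'[OF m'] by simp
  also have "\<dots> = ?X"
  proof (rule nn_integral_cong)
    fix t
    have "(\<integral>\<^sup>+u. g t * g u * indicator {t..} u \<partial>lborel) =
        ennreal \<bar>1 :: real\<bar> * (\<integral>\<^sup>+s. g t * g (t + 1 * s) * indicator {t..} (t + 1 * s) \<partial>lborel)"
      by (rule nn_integral_real_affine) (auto simp: indicator_def)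
    then show "(\<integral>\<^sup>+s. g t * g (s + t) * indicator {0..} s \<partial>lborel) = (\<integral>\<^sup>+u. g t * g u * indicator {t..} u \<partial>lborel)"
      by (simp add: indicator_def add.commute)
  qed
  finally have X: "(\<integral>\<^sup>+s\<in>{0..}. (\<integral>\<^sup>+t\<in>{0..}. f t * f (s + t) \<partial>lborel) \<partial>lborel) = ?X" .
  have X': "?X = (\<integral>\<^sup>+t. (\<integral>\<^sup>+u. g t * g u * indicator {..t} u \<partial>lborel) \<partial>lborel)"
  proof -
    have "?X = (\<integral>\<^sup>+u. (\<integral>\<^sup>+t. g t * g u * indicator {t..} u \<partial>lborel) \<partial>lborel)"
      using lborel_pair.Fubini'[OF m] by simp
    then show ?thesis
      by (simp add: indicator_def mult.commute)
  qed
  have "2 * ?X = ?X + (\<integral>\<^sup>+t. (\<integral>\<^sup>+u. g t * g u * indicator {..t} u \<partial>lborel) \<partial>lborel)"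
    by (simp flip: X' mult_2)
  also have "\<dots> = (\<integral>\<^sup>+t. (\<integral>\<^sup>+u. g t * g u * indicator {t..} u + g t * g u * indicator {..t} u \<partial>lborel) \<partial>lborel)"
  proof -
    have [measurable]: "(\<lambda>t. \<integral>\<^sup>+u. g t * g u * indicator {t..} u \<partial>lborel) \<in> borel_measurable borel"
      "(\<lambda>t. \<integral>\<^sup>+u. g t * g u * indicator {..t} u \<partial>lborel) \<in> borel_measurable borel"
      unfolding indicator_def atLeast_iff atMost_iff by measurable
    show ?thesis
      by (simp add: nn_integral_add)
  qed
  also have "\<dots> = (\<integral>\<^sup>+t. (\<integral>\<^sup>+u. g t * g u \<partial>lborel) \<partial>lborel)"
  proof (rule nn_integral_cong, rule nn_integral_cong_AE)
    fix t :: real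
    show "AE u in lborel. g t * g u * indicator {t..} u + g t * g u * indicator {..t} u = g t * g u"
      using AE_lborel_singleton[of t] by eventually_elim (auto simp: indicator_def)
  qed
  also have "\<dots> = (\<integral>\<^sup>+t. g t \<partial>lborel)\<^sup>2"
    by (simp add: nn_integral_cmult nn_integral_multc power2_eq_square)
  finally show ?thesis
    unfolding X g_def .
qed

lemma nn_integral_exp_minus_pair:
  assumes "\<delta> > (0::real)"
  shows "(\<integral>\<^sup>+s\<in>{0..}. (\<integral>\<^sup>+t\<in>{0..}. ennreal (exp (- \<delta> * (s + t))) \<partial>lborel) \<partial>lborel) = ennreal ((1 / \<delta>)\<^sup>2)"
proof -
  have "ennreal (exp (- \<delta> * (s + t))) = ennreal (exp (- \<delta> * s)) * ennreal (exp (- \<delta> * t))" for s t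
    by (simp add: ennreal_mult[symmetric] exp_add[symmetric] algebra_simps)
  then have "(\<integral>\<^sup>+t\<in>{0..}. ennreal (exp (- \<delta> * (s + t))) \<partial>lborel) =
      ennreal (exp (- \<delta> * s)) * (\<integral>\<^sup>+t\<in>{0..}. ennreal (exp (- \<delta> * t)) \<partial>lborel)" for s
    by (simp only: mult.assoc) (rule nn_integral_cmult, measurable)
  then have "(\<integral>\<^sup>+s\<in>{0..}. (\<integral>\<^sup>+t\<in>{0..}. ennreal (exp (- \<delta> * (s + t))) \<partial>lborel) \<partial>lborel) =
     (\<integral>\<^sup>+s\<in>{0..}. ennreal (exp (- \<delta> * s)) * (\<integral>\<^sup>+t\<in>{0..}. ennreal (exp (- \<delta> * t)) \<partial>lborel) \<partial>lborel)"
    by simp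
  also have "\<dots> = (\<integral>\<^sup>+s. ennreal (1 / \<delta>) * (ennreal (exp (- \<delta> * s)) * indicator {0..} s) \<partial>lborel)"
    unfolding nn_integral_exp_minus[OF assms] by (intro nn_integral_cong) (simp only: ac_simps)
  also have "\<dots> = ennreal (1 / \<delta>) * ennreal (1 / \<delta>)"
    using nn_integral_exp_minus[OF assms] by (subst nn_integral_cmult) auto
  finally show ?thesis
    using assms by (simp add: ennreal_mult[symmetric] power2_eq_square)
qed

context finite_rooted_tree
begin

lemma card_root_path_pos: "v \<in> verts \<Longrightarrow> 0 < card (root_path v)"
  using finite_path root_path_nonempty by (simp add: card_gt_0_iff)

lemma nn_integral_kcut_number:
  assumes "k > 0"
  shows "(\<integral>\<^sup>+y. of_nat y \<partial>kcut_number k) = ennreal (\<Sum>v\<in>verts. tail_integral k (card (root_path v)))"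
proof -
  have "(\<integral>\<^sup>+t\<in>{0..}. survival k (\<lambda>_. 0) (root_path v) (\<lambda>_. 0) t \<partial>lborel) =
    ennreal (tail_integral k (card (root_path v)))" if "v \<in> verts" for v
    using nn_integral_erlang_tail_power[OF assms card_root_path_pos[OF that]]
    by (simp add: survival_def)
  then show ?thesis
    by (simp add: kcut_number_def nn_integral_cuts_from sum_ennreal tail_integral_nonneg cong: sum.cong)
qed

text \<open>
  A common ancestor has to be present at the later of the two times only, so it is counted with the
  path of \<open>w\<close>.
\<close>
lemma survival_pair:
  assumes "v \<in> verts" "w \<in> verts"
  shows "survival k (\<lambda>_. 0) (root_path v \<union> root_path w) (delay w s) t =
    erlang_tail k t ^ card (root_path v - root_path w) * erlang_tail k (s + t) ^ card (root_path w)"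
proof -
  have "root_path v \<union> root_path w = (root_path v - root_path w) \<union> root_path w" by blast
  then have "survival k (\<lambda>_. 0) (root_path v \<union> root_path w) (delay w s) t =
    survival k (\<lambda>_. 0) (root_path v - root_path w) (delay w s) t * survival k (\<lambda>_. 0) (root_path w) (delay w s) t"
    unfolding survival_def using finite_path assms by (simp only: prod.union_disjoint finite_Diff Diff_disjoint Int_commute)
  also have "survival k (\<lambda>_. 0) (root_path v - root_path w) (delay w s) t = (\<Prod>u\<in>root_path v - root_path w. erlang_tail k t)"
    unfolding survival_def by (intro prod.cong) (auto simp: delay_def)
  also have "survival k (\<lambda>_. 0) (root_path w) (delay w s) t = (\<Prod>u\<in>root_path w. erlang_tail k (s + t))"
    unfolding survival_def by (intro prod.cong) (auto simp: delay_def)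
  finally show ?thesis by simp
qed

text \<open>
  Dropping all but \<open>a\<close> factors at each time decouples the two vertices, at the price of losing the common
  ancestors.
\<close>
lemma pair_integral_le_square:
  assumes "k > 0" "v \<in> verts" "w \<in> verts"
    and a: "0 < a" "a \<le> card (root_path v - root_path w)" "a \<le> card (root_path w)"
  shows "2 * pair_integral k (\<lambda>_. 0) v w \<le> ennreal ((tail_integral k a)\<^sup>2)"
proof -
  let ?f = "\<lambda>t. ennreal (erlang_tail k t ^ a)"
  have "pair_integral k (\<lambda>_. 0) v w \<le> (\<integral>\<^sup>+s\<in>{0..}. (\<integral>\<^sup>+t\<in>{0..}. ?f t * ?f (s + t) \<partial>lborel) \<partial>lborel)"
    unfolding pair_integral_def
  proof (intro nn_integral_mono)
    fix s :: real
    have "(\<integral>\<^sup>+t\<in>{0..}. survival k (\<lambda>_. 0) (root_path v \<union> root_path w) (delay w s) t \<partial>lborel) \<le>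
      (\<integral>\<^sup>+t\<in>{0..}. ?f t * ?f (s + t) \<partial>lborel)" if s: "0 \<le> s"
    proof (intro nn_integral_mono)
      fix t :: real
      have "survival k (\<lambda>_. 0) (root_path v \<union> root_path w) (delay w s) t \<le> erlang_tail k t ^ a * erlang_tail k (s + t) ^ a"
        if "0 \<le> t"
        unfolding survival_pair[OF assms(2,3)] using s that a
        by (intro mult_mono power_decreasing zero_le_power erlang_tail_nonneg erlang_tail_le_1) auto
      then show "ennreal (survival k (\<lambda>_. 0) (root_path v \<union> root_path w) (delay w s) t) * indicator {0..} t
          \<le> ?f t * ?f (s + t) * indicator {0..} t"
        using s by (auto simp: indicator_def ennreal_mult'[symmetric] erlang_tail_nonneg intro!: ennreal_leI)
    qed
    then show "(\<integral>\<^sup>+t\<in>{0..}. survival k (\<lambda>_. 0) (root_path v \<union> root_path w) (delay w s) t \<partial>lborel) * indicator {0..} s \<le>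
      (\<integral>\<^sup>+t\<in>{0..}. ?f t * ?f (s + t) \<partial>lborel) * indicator {0..} s"
      by (auto simp: indicator_def)
  qed
  then have "2 * pair_integral k (\<lambda>_. 0) v w \<le>
      2 * (\<integral>\<^sup>+s\<in>{0..}. (\<integral>\<^sup>+t\<in>{0..}. ?f t * ?f (s + t) \<partial>lborel) \<partial>lborel)"
    by (intro mult_left_mono) auto
  also have "\<dots> = (\<integral>\<^sup>+t\<in>{0..}. ?f t \<partial>lborel)\<^sup>2"
    by (rule nn_integral_symmetric_pair) simp
  also have "\<dots> = ennreal ((tail_integral k a)\<^sup>2)"
    using assms a by (simp add: nn_integral_erlang_tail_power ennreal_power tail_integral_nonneg)
  finally show ?thesis .
qed

end

text \<open>
  A crude bound for pairs that share too many ancestors: the root alone must be present at the later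
  time, whatever the tree.
\<close>
lemma pair_integral_bounded:
  assumes "k > 0"
  obtains C :: real where "C \<ge> 0"
    "\<And>verts root parent v w. finite_rooted_tree verts root parent \<Longrightarrow> v \<in> verts \<Longrightarrow> w \<in> verts \<Longrightarrow>
      2 * finite_rooted_tree.pair_integral root parent k (\<lambda>_. 0) v w \<le> ennreal C"
proof -
  obtain \<delta> where \<delta>: "\<delta> > 0" "\<And>t. 0 \<le> t \<Longrightarrow> erlang_tail k t \<le> exp \<delta> * exp (- \<delta> * t)"
    using erlang_tail_exp_bound[OF assms] by blast
  have "2 * finite_rooted_tree.pair_integral root parent k (\<lambda>_. 0) v w \<le> ennreal (2 * (exp \<delta> * (1 / \<delta>)\<^sup>2))"
    if tree: "finite_rooted_tree verts root parent" and vw: "v \<in> verts" "w \<in> verts" for verts :: "'v set" and root parent v w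
  proof -
    interpret finite_rooted_tree verts root parent by fact
    have "pair_integral k (\<lambda>_. 0) v w \<le>
      (\<integral>\<^sup>+s. ennreal (exp \<delta>) * ((\<integral>\<^sup>+t\<in>{0..}. ennreal (exp (- \<delta> * (s + t))) \<partial>lborel) * indicator {0..} s) \<partial>lborel)"
      unfolding pair_integral_def
    proof (intro nn_integral_mono)
      fix s :: real
      have "(\<integral>\<^sup>+t\<in>{0..}. survival k (\<lambda>_. 0) (root_path v \<union> root_path w) (delay w s) t \<partial>lborel) \<le>
        (\<integral>\<^sup>+t. ennreal (exp \<delta>) * (ennreal (exp (- \<delta> * (s + t))) * indicator {0..} t) \<partial>lborel)" if s: "0 \<le> s"
      proof (intro nn_integral_mono)
        fix t :: real
        have "survival k (\<lambda>_. 0) (root_path v \<union> root_path w) (delay w s) t \<le> exp \<delta> * exp (- \<delta> * (s + t))" if t: "0 \<le> t"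
        proof -
          have "survival k (\<lambda>_. 0) (root_path v \<union> root_path w) (delay w s) t \<le> 1 * erlang_tail k (s + t) ^ 1"
            unfolding survival_pair[OF vw] using s t card_root_path_pos[OF vw(2)]
            by (intro mult_mono power_le_one power_decreasing zero_le_power erlang_tail_nonneg erlang_tail_le_1) auto
          with \<delta>(2)[of "s + t"] s t show ?thesis by simp
        qed
        then show "ennreal (survival k (\<lambda>_. 0) (root_path v \<union> root_path w) (delay w s) t) * indicator {0..} t
           \<le> ennreal (exp \<delta>) * (ennreal (exp (- \<delta> * (s + t))) * indicator {0..} t)"
          by (auto simp: indicator_def ennreal_mult'[symmetric] intro!: ennreal_leI)
      qed
      also have "\<dots> = ennreal (exp \<delta>) * (\<integral>\<^sup>+t\<in>{0..}. ennreal (exp (- \<delta> * (s + t))) \<partial>lborel)"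
        by (rule nn_integral_cmult) measurable
      finally show "(\<integral>\<^sup>+t\<in>{0..}. survival k (\<lambda>_. 0) (root_path v \<union> root_path w) (delay w s) t \<partial>lborel) * indicator {0..} s
        \<le> ennreal (exp \<delta>) * ((\<integral>\<^sup>+t\<in>{0..}. ennreal (exp (- \<delta> * (s + t))) \<partial>lborel) * indicator {0..} s)"
        by (auto simp: indicator_def)
    qed
    also have "\<dots> = ennreal (exp \<delta>) * ennreal ((1 / \<delta>)\<^sup>2)"
      unfolding nn_integral_exp_minus_pair[OF \<delta>(1), symmetric] by (rule nn_integral_cmult) measurable
    also have "\<dots> = ennreal (exp \<delta> * (1 / \<delta>)\<^sup>2)"
      by (simp add: ennreal_mult)
    finally have "2 * pair_integral k (\<lambda>_. 0) v w \<le> 2 * ennreal (exp \<delta> * (1 / \<delta>)\<^sup>2)"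
      by (rule mult_left_mono) simp
    then show ?thesis
      by (simp add: ennreal_mult)
  qed
  then show thesis
    by (intro that[of "2 * (exp \<delta> * (1 / \<delta>)\<^sup>2)"] mult_nonneg_nonneg) auto
qed

section \<open>From moments to weak convergence\<close>

text \<open>
  Chebyshev's inequality around the limit \<open>c\<close>. As \<open>c \<ge> 0\<close>, a lower bound for the first moment and an upper
  bound for the second one control the mean square distance to \<open>c\<close>.
\<close>
lemma second_moment_weak_conv:
  fixes p :: "nat \<Rightarrow> nat pmf" and \<alpha> A B :: "nat \<Rightarrow> real"
  assumes c: "0 \<le> c"
    and ev: "\<forall>\<^sub>F n in sequentially. 0 \<le> \<alpha> n \<and> 0 \<le> A n \<and> 0 \<le> B n \<and> 
       ennreal (A n) \<le> (\<integral>\<^sup>+y. of_nat y \<partial>p n) \<and> (\<integral>\<^sup>+y. of_nat (y * Suc y) \<partial>p n) \<le> ennreal (B n)"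
    and A: "(\<lambda>n. \<alpha> n * A n) \<longlonglongrightarrow> c" and B: "(\<lambda>n. (\<alpha> n)\<^sup>2 * B n) \<longlonglongrightarrow> c\<^sup>2"
  shows "weak_conv_m (\<lambda>n. distr (measure_pmf (p n)) borel (\<lambda>x. \<alpha> n * real x)) (return borel c)"
proof -
  have dev: "(\<lambda>n. measure (p n) {y. \<epsilon> \<le> \<bar>\<alpha> n * real y - c\<bar>}) \<longlonglongrightarrow> 0" if \<epsilon>: "\<epsilon> > 0" for \<epsilon>
  proof (rule tendsto_sandwich[where f = "\<lambda>_. 0"])
    show "\<forall>\<^sub>F n in sequentially. measure (p n) {y. \<epsilon> \<le> \<bar>\<alpha> n * real y - c\<bar>}
        \<le> ((\<alpha> n)\<^sup>2 * B n - 2 * c * (\<alpha> n * A n) + c\<^sup>2) / \<epsilon>\<^sup>2"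
      using ev
    proof eventually_elim
      case (elim n)
      have "(\<integral>\<^sup>+y. ennreal ((real y)\<^sup>2) \<partial>p n) \<le> (\<integral>\<^sup>+y. of_nat (y * Suc y) \<partial>p n)"
        by (intro nn_integral_mono)
          (simp only: ennreal_of_nat_eq_real_of_nat, intro ennreal_leI, simp add: power2_eq_square algebra_simps)
      also have "\<dots> \<le> ennreal (B n)" using elim by simp
      finally have sq: "(\<integral>\<^sup>+y. ennreal ((real y)\<^sup>2) \<partial>p n) \<le> ennreal (B n)" .
      then have int2: "integrable (p n) (\<lambda>y. (real y)\<^sup>2)"
        by (intro integrableI_nonneg) (auto intro: le_less_trans)
      have int1: "integrable (p n) real"
      proof (rule Bochner_Integration.integrable_bound[OF int2])
        have "real y \<le> (real y)\<^sup>2" for y :: nat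
          using le_square[of y] by (metis of_nat_le_iff of_nat_mult power2_eq_square)
        then show "AE y in p n. norm (real y) \<le> norm ((real y)\<^sup>2)" by simp
      qed simp
      have "ennreal (\<integral>y. (real y)\<^sup>2 \<partial>p n) \<le> ennreal (B n)"
        using sq by (subst nn_integral_eq_integral[symmetric]) (auto intro: int2)
      then have B': "(\<integral>y. (real y)\<^sup>2 \<partial>p n) \<le> B n"
        using elim by (simp add: ennreal_le_iff)
      have "ennreal (A n) \<le> ennreal (\<integral>y. real y \<partial>p n)"
        using elim int1 by (subst nn_integral_eq_integral[symmetric]) (auto simp: ennreal_of_nat_eq_real_of_nat)
      then have A': "A n \<le> (\<integral>y. real y \<partial>p n)"
        by (subst (asm) ennreal_le_iff) (auto intro!: integral_nonneg_AE)
      have expand: "(\<alpha> n * real y - c)\<^sup>2 = (\<alpha> n)\<^sup>2 * (real y)\<^sup>2 - 2 * c * \<alpha> n * real y + c\<^sup>2" for y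
        by (simp add: power2_eq_square algebra_simps)
      have int: "integrable (p n) (\<lambda>y. (\<alpha> n * real y - c)\<^sup>2)"
        unfolding expand using int1 int2 by simp
      have "measure (p n) {y. \<epsilon> \<le> \<bar>\<alpha> n * real y - c\<bar>} = measure (p n) {y \<in> space (p n). \<epsilon>\<^sup>2 \<le> (\<alpha> n * real y - c)\<^sup>2}"
        using \<epsilon> by (intro arg_cong[where f = "measure (p n)"]) (auto simp: abs_le_square_iff[symmetric])
      also have "\<dots> \<le> (\<integral>y. (\<alpha> n * real y - c)\<^sup>2 \<partial>p n) / \<epsilon>\<^sup>2"
        using \<epsilon> int by (intro integral_Markov_inequality_measure[where A = UNIV, OF int]) auto
      also have "(\<integral>y. (\<alpha> n * real y - c)\<^sup>2 \<partial>p n) = (\<alpha> n)\<^sup>2 * (\<integral>y. (real y)\<^sup>2 \<partial>p n) - 2 * c * \<alpha> n * (\<integral>y. real y \<partial>p n) + c\<^sup>2"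
        unfolding expand using int1 int2 by simp
      also have "\<dots> \<le> (\<alpha> n)\<^sup>2 * B n - 2 * c * (\<alpha> n * A n) + c\<^sup>2"
        using mult_left_mono[OF B', of "(\<alpha> n)\<^sup>2"] mult_left_mono[OF A', of "2 * c * \<alpha> n"] c elim
        by (simp add: mult.assoc)
      finally show ?case using \<epsilon> by (simp add: divide_right_mono)
    qed
    have "(\<lambda>n. ((\<alpha> n)\<^sup>2 * B n - 2 * c * (\<alpha> n * A n) + c\<^sup>2) / \<epsilon>\<^sup>2) \<longlonglongrightarrow> (c\<^sup>2 - 2 * c * c + c\<^sup>2) / \<epsilon>\<^sup>2"
      using \<epsilon> by (intro tendsto_intros A B) auto
    then show "(\<lambda>n. ((\<alpha> n)\<^sup>2 * B n - 2 * c * (\<alpha> n * A n) + c\<^sup>2) / \<epsilon>\<^sup>2) \<longlonglongrightarrow> 0"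
      by (simp add: power2_eq_square)
  qed auto
  show ?thesis
    unfolding weak_conv_m_def weak_conv_def
  proof (intro allI impI)
    fix x assume cont: "isCont (cdf (return borel c)) x"
    let ?P = "\<lambda>n. measure (p n) {y. \<alpha> n * real y \<le> x}"
    have cdf: "cdf (distr (measure_pmf (p n)) borel (\<lambda>x. \<alpha> n * real x)) x = ?P n" for n
      unfolding cdf_def by (subst measure_distr) (auto simp: vimage_def)
    have ret: "cdf (return borel c) = (\<lambda>x. if c \<le> x then 1 else 0)"
      by (auto simp: cdf_def measure_return fun_eq_iff)
    have "x \<noteq> c"
    proof
      assume "x = c"
      then have "((\<lambda>x. if c \<le> x then 1 else 0 :: real) \<longlongrightarrow> 1) (at_left c)"
        using cont unfolding ret isCont_def by (auto intro: tendsto_mono[OF at_le])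
      moreover have "((\<lambda>x. if c \<le> x then 1 else 0 :: real) \<longlongrightarrow> 0) (at_left c)"
        by (rule tendsto_eventually) (auto simp: eventually_at_filter)
      ultimately show False
        using tendsto_unique[OF trivial_limit_at_left_real] by fastforce
    qed
    then consider "x < c" | "c < x" by linarith
    then show "(\<lambda>n. cdf (distr (measure_pmf (p n)) borel (\<lambda>x. \<alpha> n * real x)) x) \<longlonglongrightarrow> cdf (return borel c) x"
      unfolding cdf
    proof cases
      case 1
      have "?P \<longlonglongrightarrow> 0"
      proof (rule tendsto_sandwich[OF _ _ tendsto_const dev[of "c - x"]])
        show "\<forall>\<^sub>F n in sequentially. ?P n \<le> measure (p n) {y. c - x \<le> \<bar>\<alpha> n * real y - c\<bar>}"
          by (intro always_eventually allI measure_pmf.finite_measure_mono) auto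
      qed (use 1 in auto)
      then show "?P \<longlonglongrightarrow> cdf (return borel c) x" using 1 by (simp add: ret)
    next
      case 2
      have "?P \<longlonglongrightarrow> 1"
      proof (rule tendsto_sandwich)
        show "\<forall>\<^sub>F n in sequentially. 1 - measure (p n) {y. x - c \<le> \<bar>\<alpha> n * real y - c\<bar>} \<le> ?P n"
        proof (intro always_eventually allI)
          fix n
          have "1 - measure (p n) {y. x - c \<le> \<bar>\<alpha> n * real y - c\<bar>} = measure (p n) (- {y. x - c \<le> \<bar>\<alpha> n * real y - c\<bar>})"
            by (subst measure_pmf.prob_compl[symmetric]) (auto simp: Compl_eq_Diff_UNIV)
          also have "\<dots> \<le> ?P n"
            by (intro measure_pmf.finite_measure_mono) auto
          finally show "1 - measure (p n) {y. x - c \<le> \<bar>\<alpha> n * real y - c\<bar>} \<le> ?P n" .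
        qed
        have "(\<lambda>n. 1 - measure (p n) {y. x - c \<le> \<bar>\<alpha> n * real y - c\<bar>}) \<longlonglongrightarrow> 1 - 0"
          using 2 by (intro tendsto_intros dev) auto
        then show "(\<lambda>n. 1 - measure (p n) {y. x - c \<le> \<bar>\<alpha> n * real y - c\<bar>}) \<longlonglongrightarrow> 1" by simp
      qed auto
      then show "?P \<longlonglongrightarrow> cdf (return borel c) x" using 2 by (simp add: ret)
    qed
  qed
qed

section \<open>Complete binary trees\<close>

lemma cbt_root_path:
  "j < 2 ^ d \<Longrightarrow> cbt.root_path (d, j) = (\<lambda>i. (i, j div 2 ^ (d - i))) ` {..d}"
proof (induction d arbitrary: j)
  case 0
  then show ?case
    using cbt.path_root by (simp add: cbt_root_def)
next
  case (Suc d)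
  have "cbt.root_path (Suc d, j) = insert (Suc d, j) (cbt.root_path (d, j div 2))"
    using cbt.path_step[of "(Suc d, j)"] by (simp add: cbt_root_def cbt_parent_def)
  also have "cbt.root_path (d, j div 2) = (\<lambda>i. (i, j div 2 ^ (Suc d - i))) ` {..d}"
    using Suc by (subst Suc.IH) (auto simp: Suc_diff_le div_mult2_eq intro!: image_cong)
  also have "insert (Suc d, j) \<dots> = (\<lambda>i. (i, j div 2 ^ (Suc d - i))) ` {..Suc d}"
    by (auto simp: atMost_Suc)
  finally show ?case .
qed

lemma card_cbt_root_path: "(d, j) \<in> cbt_verts n \<Longrightarrow> card (cbt.root_path (d, j)) = Suc d"
  by (subst cbt_root_path) (auto simp: card_image inj_on_def dest: cbt_verts_bound)

text \<open>
  The position within level \<open>M\<close> of the ancestor at depth \<open>M\<close>; meaningful only for vertices of depth at least \<open>M\<close>.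
\<close>
definition ancestor_at :: "nat \<Rightarrow> nat \<times> nat \<Rightarrow> nat" where
  "ancestor_at M = (\<lambda>(d, j). j div 2 ^ (d - M))"

lemma card_cbt_root_path_diff:
  assumes v: "v \<in> cbt_verts n" and w: "w \<in> cbt_verts n"
    and M: "M \<le> fst v" "M \<le> fst w" and ne: "ancestor_at M v \<noteq> ancestor_at M w"
  shows "Suc (fst v) - M \<le> card (cbt.root_path v - cbt.root_path w)"
proof -
  obtain d j e l where dj: "v = (d, j)" "w = (e, l)" by fastforce
  have jl: "j < 2 ^ d" "l < 2 ^ e"
    using v w dj cbt_verts_bound by auto
  have anc: "x div 2 ^ (y - i) div 2 ^ (i - M) = x div 2 ^ (y - M)" if "M \<le> i" "i \<le> y" for x y i :: nat
  proof -
    have "y - M = (y - i) + (i - M)" using that by simp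
    then show ?thesis by (simp add: power_add div_mult2_eq)
  qed
  have "(\<lambda>i. (i, j div 2 ^ (d - i))) ` {M..d} \<subseteq> cbt.root_path v - cbt.root_path w"
  proof (intro subsetI, elim imageE)
    fix u i assume i: "u = (i, j div 2 ^ (d - i))" "i \<in> {M..d}"
    have "j div 2 ^ (d - i) \<noteq> l div 2 ^ (e - i)" if "i \<le> e"
      using anc[of i d j] anc[of i e l] i that ne by (auto simp: dj ancestor_at_def)
    then show "u \<in> cbt.root_path v - cbt.root_path w"
      using i jl by (auto simp: dj cbt_root_path)
  qed
  then have "card ((\<lambda>i. (i, j div 2 ^ (d - i))) ` {M..d}) \<le> card (cbt.root_path v - cbt.root_path w)"
    using cbt.finite_path[OF v] by (intro card_mono) auto
  then show ?thesis
    by (subst (asm) card_image) (auto simp: inj_on_def dj)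
qed

lemma cbt_depth_le: "v \<in> cbt_verts n \<Longrightarrow> fst v \<le> cbt_height n"
  by (auto simp: cbt_verts_def)

lemma card_cbt_shallow: "card {v \<in> cbt_verts n. fst v < m} \<le> 2 ^ m"
proof -
  have "card {v \<in> cbt_verts n. fst v < m} \<le> card (Sigma {..<m} (\<lambda>d. {..<2 ^ d :: nat}))"
    by (intro card_mono) (auto dest: cbt_verts_bound)
  also have "\<dots> = 2 ^ m - 1"
    by (simp add: lessThan_atLeast0 sum_power2)
  finally show ?thesis by simp
qed

lemma card_cbt_descendants:
  assumes "M \<le> cbt_height n"
  shows "card {v \<in> cbt_verts n. M \<le> fst v \<and> ancestor_at M v = a} \<le> 2 * 2 ^ (cbt_height n - M)"
proof -
  let ?h = "cbt_height n"
  have "card {v \<in> cbt_verts n. M \<le> fst v \<and> ancestor_at M v = a} \<le>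
    card (Sigma {M..?h} (\<lambda>d. {a * 2 ^ (d - M)..<Suc a * 2 ^ (d - M)}))"
  proof (intro card_mono subsetI)
    fix v assume "v \<in> {v \<in> cbt_verts n. M \<le> fst v \<and> ancestor_at M v = a}"
    then obtain d j where v: "v = (d, j)" "v \<in> cbt_verts n" "M \<le> d" "j div 2 ^ (d - M) = a"
      by (cases v) (auto simp: ancestor_at_def)
    have "a * 2 ^ (d - M) \<le> j" "j < Suc a * 2 ^ (d - M)"
      using v(4) div_times_less_eq_dividend[of j "2 ^ (d - M)"] dividend_less_div_times[of "2 ^ (d - M)" j]
      by (auto simp: add.commute)
    then show "v \<in> Sigma {M..?h} (\<lambda>d. {a * 2 ^ (d - M)..<Suc a * 2 ^ (d - M)})"
      using v cbt_depth_le[OF v(2)] by auto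
  qed auto
  also have "\<dots> = (\<Sum>d = M..?h. 2 ^ (d - M))"
    by simp
  also have "\<dots> = (\<Sum>i<Suc (?h - M). 2 ^ i)"
    using assms by (intro sum.reindex_bij_witness[of _ "\<lambda>i. i + M" "\<lambda>d. d - M"]) auto
  also have "\<dots> = 2 ^ Suc (?h - M) - 1"
    by (simp only: lessThan_atLeast0 sum_power2)
  finally show ?thesis by simp
qed

lemma nn_integral_cbt_kcut_number_lower:
  assumes "k > 0" "n > 0"
  shows "ennreal (real n * tail_integral k (Suc (cbt_height n))) \<le> (\<integral>\<^sup>+y. of_nat y \<partial>cbt.kcut_number n k)"
proof -
  have "real n * tail_integral k (Suc (cbt_height n)) = (\<Sum>v\<in>cbt_verts n. tail_integral k (Suc (cbt_height n)))"
    using assms by (simp add: card_cbt_verts)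
  also have "\<dots> \<le> (\<Sum>v\<in>cbt_verts n. tail_integral k (card (cbt.root_path v)))"
  proof (intro sum_mono tail_integral_antimono assms)
    fix v assume v: "v \<in> cbt_verts n"
    then have "card (cbt.root_path v) = Suc (fst v)"
      using card_cbt_root_path by (cases v) auto
    then show "0 < card (cbt.root_path v)" "card (cbt.root_path v) \<le> Suc (cbt_height n)"
      using cbt_depth_le[OF v] by auto
  qed
  finally show ?thesis
    unfolding cbt.nn_integral_kcut_number[OF assms(1)] by (rule ennreal_leI)
qed

text \<open>
  Unless one of the vertices has depth below \<open>cbt_height n - M\<close> or both have the same ancestor at depth \<open>M\<close>,
  their paths have at least \<open>cbt_height n + 1 - 2 * M\<close> vertices each that are not shared; such pairs contribute
  as if they were independent. All others make up a fraction of at most \<open>4 / 2 ^ M\<close> of the pairs, and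
  the crude bound \<open>C\<close> suffices for them.
\<close>
lemma nn_integral_cbt_kcut_number_rising_upper:
  assumes "k > 0" "n > 0" and M: "2 * M \<le> cbt_height n" and C: "0 \<le> C"
    "\<And>v w. v \<in> cbt_verts n \<Longrightarrow> w \<in> cbt_verts n \<Longrightarrow> 2 * cbt.pair_integral k (\<lambda>_. 0) v w \<le> ennreal C"
  shows "(\<integral>\<^sup>+y. of_nat (y * Suc y) \<partial>cbt.kcut_number n k) \<le>
    ennreal (real n ^ 2 * ((tail_integral k (Suc (cbt_height n) - 2 * M))\<^sup>2 + 4 * C / 2 ^ M))"
proof -
  let ?V = "cbt_verts n" and ?h = "cbt_height n"
  define a where "a = Suc ?h - 2 * M"
  define J where "J = (tail_integral k a)\<^sup>2"
  define I1 :: "nat \<times> nat \<Rightarrow> real" where "I1 v = of_bool (fst v < ?h - M)" for v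
  define I2 :: "nat \<times> nat \<Rightarrow> nat \<times> nat \<Rightarrow> real"
    where "I2 v w = of_bool (M \<le> fst v \<and> ancestor_at M v = ancestor_at M w)" for v w
  have pair: "2 * cbt.pair_integral k (\<lambda>_. 0) v w \<le> ennreal (J + C * (I1 v + I1 w + I2 v w))"
    if v: "v \<in> ?V" and w: "w \<in> ?V" for v w
  proof (cases "fst v < ?h - M \<or> fst w < ?h - M \<or> ancestor_at M v = ancestor_at M w")
    case True
    then have "1 \<le> I1 v + I1 w + I2 v w"
      using M by (auto simp: I1_def I2_def)
    then have "C * 1 \<le> C * (I1 v + I1 w + I2 v w)"
      using C(1) by (rule mult_left_mono)
    moreover have "0 \<le> J" by (simp add: J_def)
    ultimately have "C \<le> J + C * (I1 v + I1 w + I2 v w)" by simp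
    with C(2)[OF v w] show ?thesis
      by (meson ennreal_leI order_trans)
  next
    case False
    have "2 * cbt.pair_integral k (\<lambda>_. 0) v w \<le> ennreal J"
      unfolding J_def
    proof (rule cbt.pair_integral_le_square[OF assms(1) v w])
      show "0 < a" using M by (simp add: a_def)
      have "Suc (fst v) - M \<le> card (cbt.root_path v - cbt.root_path w)"
        using False M by (intro card_cbt_root_path_diff[OF v w]) auto
      then show "a \<le> card (cbt.root_path v - cbt.root_path w)"
        using False M unfolding a_def by linarith
      have "card (cbt.root_path w) = Suc (fst w)"
        using w card_cbt_root_path by (cases w) auto
      then show "a \<le> card (cbt.root_path w)"
        using False M unfolding a_def by linarith
    qed
    also have "\<dots> \<le> ennreal (J + C * (I1 v + I1 w + I2 v w))"
      using C(1) by (intro ennreal_leI) (simp add: I1_def I2_def)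
    finally show ?thesis .
  qed
  have fin: "finite ?V" by (rule cbt.finite_verts)
  have I1: "(\<Sum>v\<in>?V. I1 v) \<le> 2 ^ (?h - M)"
  proof -
    have "(\<Sum>v\<in>?V. I1 v) = real (card {v \<in> ?V. fst v < ?h - M})"
      unfolding I1_def using fin by (simp add: Int_def)
    also have "\<dots> \<le> real (2 ^ (?h - M))"
      using card_cbt_shallow by (simp only: of_nat_le_iff)
    finally show ?thesis by simp
  qed
  have I2: "(\<Sum>v\<in>?V. I2 v w) \<le> 2 * 2 ^ (?h - M)" for w
  proof -
    have "(\<Sum>v\<in>?V. I2 v w) = real (card {v \<in> ?V. M \<le> fst v \<and> ancestor_at M v = ancestor_at M w})"
      unfolding I2_def using fin by (simp add: Int_def)
    also have "\<dots> \<le> real (2 * 2 ^ (?h - M))"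
      using card_cbt_descendants[of M n] M by (simp only: of_nat_le_iff)
    finally show ?thesis by simp
  qed
  have nonneg: "0 \<le> J + C * (I1 v + I1 w + I2 v w)" for v w
    using C(1) by (simp add: J_def I1_def I2_def)
  have "(\<integral>\<^sup>+y. of_nat (y * Suc y) \<partial>cbt.kcut_number n k) = (\<Sum>v\<in>?V. \<Sum>w\<in>?V. 2 * cbt.pair_integral k (\<lambda>_. 0) v w)"
    unfolding cbt.kcut_number_def cbt.nn_integral_cuts_from_rising by (simp add: sum_distrib_left)
  also have "\<dots> \<le> (\<Sum>v\<in>?V. \<Sum>w\<in>?V. ennreal (J + C * (I1 v + I1 w + I2 v w)))"
    by (intro sum_mono pair)
  also have "\<dots> = ennreal (\<Sum>v\<in>?V. \<Sum>w\<in>?V. J + C * (I1 v + I1 w + I2 v w))"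
    using nonneg by (simp add: sum_ennreal sum_nonneg)
  also have "\<dots> \<le> ennreal (real n ^ 2 * (J + 4 * C / 2 ^ M))"
  proof (rule ennreal_leI)
    have "(\<Sum>v\<in>?V. \<Sum>w\<in>?V. J + C * (I1 v + I1 w + I2 v w)) =
        (real n)\<^sup>2 * J + C * (real n * (\<Sum>v\<in>?V. I1 v) + real n * (\<Sum>v\<in>?V. I1 v) + (\<Sum>w\<in>?V. \<Sum>v\<in>?V. I2 v w))"
      using assms by (subst sum.swap[of "\<lambda>w v. I2 v w" ?V ?V])
        (simp add: sum.distrib sum_distrib_left[symmetric] sum_distrib_right[symmetric] card_cbt_verts
          power2_eq_square algebra_simps)
    also have "\<dots> \<le> (real n)\<^sup>2 * J + C * (real n * 2 ^ (?h - M) + real n * 2 ^ (?h - M) + (\<Sum>w\<in>?V. 2 * 2 ^ (?h - M)))"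
      using C(1) by (intro add_left_mono mult_left_mono add_mono sum_mono I1 I2) auto
    also have "\<dots> = (real n)\<^sup>2 * J + 4 * C * real n * 2 ^ (?h - M)"
      using assms by (simp add: card_cbt_verts algebra_simps)
    also have "(2::real) ^ (?h - M) = 2 ^ ?h / 2 ^ M"
      using M by (intro power_diff) auto
    also have "(real n)\<^sup>2 * J + 4 * C * real n * (2 ^ ?h / 2 ^ M) \<le> (real n)\<^sup>2 * J + 4 * C * real n * (real n / 2 ^ M)"
    proof (intro add_left_mono mult_left_mono divide_right_mono)
      show "2 ^ ?h \<le> real n"
        using cbt_height_bounds(1)[OF assms(2)] by (metis of_nat_le_iff of_nat_numeral of_nat_power)
    qed (use C in auto)
    also have "\<dots> = real n ^ 2 * (J + 4 * C / 2 ^ M)"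
      by (simp add: power2_eq_square algebra_simps)
    finally show "(\<Sum>v\<in>?V. \<Sum>w\<in>?V. J + C * (I1 v + I1 w + I2 v w)) \<le> real n ^ 2 * (J + 4 * C / 2 ^ M)" .
  qed
  finally show ?thesis
    unfolding J_def a_def .
qed

lemma log_scaled_tail_integral:
  fixes a :: "nat \<Rightarrow> nat"
  assumes "k > 0" and a: "filterlim a at_top sequentially"
    and ratio: "(\<lambda>n. log 2 (real n) / real (a n)) \<longlonglongrightarrow> 1"
  shows "(\<lambda>n. log 2 (real n) powr (1 / k) * tail_integral k (a n)) \<longlonglongrightarrow> fact k powr (1 / k) * Gamma (1 + 1 / k)"
proof -
  have "(\<lambda>n. (log 2 (real n) / real (a n)) powr (1 / k) * (real (a n) powr (1 / k) * tail_integral k (a n)))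
    \<longlonglongrightarrow> 1 powr (1 / k) * (fact k powr (1 / k) * Gamma (1 + 1 / k))"
    by (intro tendsto_mult tendsto_powr ratio tendsto_const filterlim_compose[OF tail_integral_asymptotics[OF assms(1)] a]) auto
  moreover have "\<forall>\<^sub>F n in sequentially. (log 2 (real n) / real (a n)) powr (1 / k) * (real (a n) powr (1 / k) * tail_integral k (a n)) =
    log 2 (real n) powr (1 / k) * tail_integral k (a n)"
    using eventually_gt_at_top[of 1] eventually_compose_filterlim[OF eventually_gt_at_top[of 0] a]
    by eventually_elim (simp add: powr_divide)
  ultimately show ?thesis
    by (auto intro: Lim_transform_eventually)
qed

section \<open>The limit theorem\<close>

theorem mainTheorem2:
  fixes k :: nat
  assumes "k \<ge> 2"
  shows "weak_conv_m
           (\<lambda>n. distr (measure_pmf (cbt.kcut_number n k)) borel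
                  (\<lambda>x. (1 / real n) * (log 2 (real n)) powr (1 / real k) * real x))
           (return borel (fact k powr (1 / real k) * Gamma (1 + 1 / real k)))"
proof -
  have k: "k > 0" using assms by simp
  obtain C where C: "C \<ge> 0"
    "\<And>n v w. v \<in> cbt_verts n \<Longrightarrow> w \<in> cbt_verts n \<Longrightarrow> 2 * cbt.pair_integral k (\<lambda>_. 0) v w \<le> ennreal C"
    using pair_integral_bounded[OF k] cbt.finite_rooted_tree_axioms by metis
  define c where "c = fact k powr (1 / real k) * Gamma (1 + 1 / real k)"
  \<comment> \<open>Negligible against the height, while \<open>2 ^ M n\<close> outgrows every power of \<open>log 2 n\<close>.\<close>
  define M where "M n = nat \<lfloor>sqrt (log 2 (real n))\<rfloor>" for n :: nat
  define L where "L n = log 2 (real n) powr (1 / real k)" for n :: nat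
  define a where "a n = Suc (cbt_height n) - 2 * M n" for n
  define A where "A n = real n * tail_integral k (Suc (cbt_height n))" for n :: nat
  define B where "B n = real n ^ 2 * ((tail_integral k (a n))\<^sup>2 + 4 * C / 2 ^ M n)" for n
  have M: "\<forall>\<^sub>F n in sequentially. 2 * M n \<le> cbt_height n"
  proof -
    have "\<forall>\<^sub>F n in sequentially. 2 * real (nat \<lfloor>sqrt (log 2 (real n))\<rfloor>) \<le> real (nat \<lfloor>log 2 (real n)\<rfloor>)"
      by real_asymp
    then show ?thesis
      by eventually_elim (unfold M_def cbt_height_def, linarith)
  qed
  have pos: "\<forall>\<^sub>F n in sequentially. 0 < (n::nat)"
    by (rule eventually_gt_at_top)
  have "weak_conv_m (\<lambda>n. distr (measure_pmf (cbt.kcut_number n k)) borel (\<lambda>x. (1 / real n) * L n * real x)) (return borel c)"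
  proof (rule second_moment_weak_conv)
    show "0 \<le> c" unfolding c_def by (intro mult_nonneg_nonneg less_imp_le[OF Gamma_real_pos]) (simp_all add: add_pos_nonneg)
    show "\<forall>\<^sub>F n in sequentially. 0 \<le> 1 / real n * L n \<and> 0 \<le> A n \<and> 0 \<le> B n \<and>
       ennreal (A n) \<le> (\<integral>\<^sup>+y. of_nat y \<partial>cbt.kcut_number n k) \<and>
       (\<integral>\<^sup>+y. of_nat (y * Suc y) \<partial>cbt.kcut_number n k) \<le> ennreal (B n)"
      using M pos
    proof eventually_elim
      case (elim n)
      have "ennreal (A n) \<le> (\<integral>\<^sup>+y. of_nat y \<partial>cbt.kcut_number n k)"
        unfolding A_def by (rule nn_integral_cbt_kcut_number_lower) (use k elim in auto)
      moreover have "(\<integral>\<^sup>+y. of_nat (y * Suc y) \<partial>cbt.kcut_number n k) \<le> ennreal (B n)"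
        unfolding B_def a_def by (rule nn_integral_cbt_kcut_number_rising_upper) (use k elim C in auto)
      ultimately show ?case
        using C by (simp add: L_def A_def B_def tail_integral_nonneg del: of_nat_mult)
    qed
    have "(\<lambda>n. L n * tail_integral k (Suc (cbt_height n))) \<longlonglongrightarrow> c"
      unfolding L_def c_def
    proof (rule log_scaled_tail_integral[OF k])
      show "filterlim (\<lambda>n. Suc (cbt_height n)) at_top sequentially"
        unfolding cbt_height_def Suc_eq_plus1 by real_asymp
      show "(\<lambda>n. log 2 (real n) / real (Suc (cbt_height n))) \<longlonglongrightarrow> 1"
        unfolding cbt_height_def of_nat_Suc by real_asymp
    qed
    then show "(\<lambda>n. 1 / real n * L n * A n) \<longlonglongrightarrow> c"
      by (rule Lim_transform_eventually) (use pos in \<open>eventually_elim, simp add: A_def\<close>)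
    have J: "(\<lambda>n. L n * tail_integral k (a n)) \<longlonglongrightarrow> c"
      unfolding L_def c_def
    proof (rule log_scaled_tail_integral[OF k])
      show "filterlim a at_top sequentially"
        unfolding a_def cbt_height_def M_def Suc_eq_plus1 by real_asymp
      have "(\<lambda>n. log 2 (real n) / (real (nat \<lfloor>log 2 (real n)\<rfloor>) + 1 - 2 * real (nat \<lfloor>sqrt (log 2 (real n))\<rfloor>))) \<longlonglongrightarrow> 1"
        by real_asymp
      then show "(\<lambda>n. log 2 (real n) / real (a n)) \<longlonglongrightarrow> 1"
      proof (rule Lim_transform_eventually)
        show "\<forall>\<^sub>F n in sequentially. log 2 (real n) / (real (nat \<lfloor>log 2 (real n)\<rfloor>) + 1 - 2 * real (nat \<lfloor>sqrt (log 2 (real n))\<rfloor>)) =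
          log 2 (real n) / real (a n)"
          using M by eventually_elim (simp add: a_def M_def cbt_height_def of_nat_diff add.commute)
      qed
    qed
    have "(\<lambda>n. (L n)\<^sup>2 / 2 ^ M n) \<longlonglongrightarrow> 0"
    proof -
      have "(\<lambda>n. (log 2 (real n) powr (1 / real k))\<^sup>2 / 2 powr real (nat \<lfloor>sqrt (log 2 (real n))\<rfloor>)) \<longlonglongrightarrow> 0"
        using k by real_asymp
      then show ?thesis
        by (simp add: L_def M_def powr_realpow)
    qed
    then have "(\<lambda>n. (L n * tail_integral k (a n))\<^sup>2 + 4 * C * ((L n)\<^sup>2 / 2 ^ M n)) \<longlonglongrightarrow> c\<^sup>2 + 4 * C * 0"
      by (intro tendsto_intros J)
    then have "(\<lambda>n. (L n * tail_integral k (a n))\<^sup>2 + 4 * C * ((L n)\<^sup>2 / 2 ^ M n)) \<longlonglongrightarrow> c\<^sup>2"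
      by simp
    then show "(\<lambda>n. (1 / real n * L n)\<^sup>2 * B n) \<longlonglongrightarrow> c\<^sup>2"
      by (rule Lim_transform_eventually)
        (use pos in \<open>eventually_elim, simp add: B_def power_mult_distrib power_divide field_simps\<close>)
  qed
  then show ?thesis
    unfolding L_def c_def .
qed

end
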